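(* Let $q$ be a prime with $q\equiv1\pmod4$, and write $q=a^2+b^2$ with $a,b\in\mathbb Z$, $a$ odd. Let $p$ be an odd prime with $p\nmid aq$. Then $$(-1)^{\frac{p-1}2\cdot\frac{q-1}4}\sum_{k=0}^{[p/4]}\binom{4k}{2k}\Big(\frac{b^2}{16q}\Big)^k\equiv\begin{cases}\pm1\pmod p&\text{if }p^{\frac{q-1}4}\equiv\pm1\pmod q,\\ \mp\frac ba\pmod p&\text{if }p^{\frac{q-1}4}\equiv\pm\frac ba\pmod q.\end{cases}$$
   Context: $[x]$ is the greatest integer $\le x$. $\frac ba$ is interpreted modulo $q$ as a residue and modulo $p$ as the rational $b/a$. *)

theory Defs
  imports "HOL-Number_Theory.Number_Theory"
begin

definition rat_cong_mod :: "rat \<Rightarrow> rat \<Rightarrow> nat \<Rightarrow> bool" where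
  "rat_cong_mod x y p \<longleftrightarrow> int p dvd fst (quotient_of (x - y))"

end

theory Submission
  imports Defs "Jordan_Normal_Form.Char_Poly"
begin

text \<open>
  Put \<open>n = (p - 1)/2\<close>. Modulo \<open>p\<close> one has \<open>binom(4k, 2k) = 16\<^sup>k binom(n, 2k)\<close>, so the sum is
  congruent to \<open>((1 + b/r)\<^sup>n + (1 - b/r)\<^sup>n)/2\<close> for any square root \<open>r\<close> of \<open>q\<close>.
  Let \<open>\<chi>\<close> be the quartic character modulo \<open>q\<close> with \<open>\<chi>(x) = \<i>\<^sup>k\<close> if \<open>x\<close> raised to \<open>(q - 1)/4\<close>
  is \<open>(b/a)\<^sup>k\<close>. Its Gauss sum \<open>G\<close> satisfies \<open>G\<^sup>2 = J g\<close>, where \<open>g\<close> is the Gauss sum of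
  \<open>\<chi>\<^sup>2\<close>, a square root of \<open>q\<close>, and the Jacobi sum \<open>J = J(\<chi>, \<chi>)\<close> is \<open>\<plusminus>(a + b\<i>)\<close>: it has norm \<open>q\<close>
  and odd real part, and it vanishes modulo the prime above \<open>q\<close> that defines \<open>\<chi>\<close>. Choosing
  \<open>r = \<plusminus>g\<close> with the sign of \<open>J\<close> gives \<open>G\<^sup>2 = (a + b\<i>) r\<close>. Raising \<open>G\<close> and \<open>g\<close> to the \<open>p\<close>-th power
  modulo \<open>p\<close> evaluates powers of \<open>(a + b\<i>) r\<close> in terms of \<open>\<chi>(p)\<close>, and the identity
  \<open>(b + a\<i> + r)\<^sup>2 = 2 (b + a\<i>) (b + r)\<close> reduces the powers of \<open>1 \<plusminus> b/r\<close> to these.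
  The congruences take place in the ring generated over the integers localised at \<open>p\<close> by a
  primitive \<open>4q\<close>-th root of unity; it does not contain \<open>1/p\<close> because the elements of the ring
  generated over the integers are algebraic integers.
\<close>

section \<open>Rings generated by a root of unity, localised at a prime\<close>

text \<open>The vector of the \<open>v i\<close> is an eigenvector of the integer matrix
  \<open>A\<close> for the eigenvalue \<open>z\<close>, so \<open>z\<close> is a root of the
  characteristic polynomial, which is monic with integer coefficients.\<close>

lemma algebraic_int_integer_matrix:
  fixes z :: complex and v :: "nat \<Rightarrow> complex" and A :: "nat \<Rightarrow> nat \<Rightarrow> int"
  assumes eq: "\<And>i. i < n \<Longrightarrow> z * v i = (\<Sum>j<n. of_int (A i j) * v j)"
    and nz: "l < n" "v l \<noteq> 0"
  shows "algebraic_int z"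
proof -
  define B where "B = mat n n (\<lambda>(i, j). A i j)"
  define C :: "complex mat" where "C = map_mat of_int B"
  have B: "B \<in> carrier_mat n n" and C: "C \<in> carrier_mat n n"
    by (auto simp: B_def C_def)
  have "eigenvector C (vec n v) z"
    unfolding eigenvector_def
  proof (intro conjI)
    show "vec n v \<in> carrier_vec (dim_row C)" using C by auto
    show "vec n v \<noteq> 0\<^sub>v (dim_row C)"
    proof
      assume "vec n v = 0\<^sub>v (dim_row C)"
      then have "vec n v $ l = 0\<^sub>v n $ l" using C by simp
      with nz show False by simp
    qed
    show "C *\<^sub>v vec n v = z \<cdot>\<^sub>v vec n v"
      by (intro eq_vecI)
        (auto simp: B_def C_def scalar_prod_def eq lessThan_atLeast0)
  qed
  then have "eigenvalue C z" unfolding eigenvalue_def by blast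
  then have "poly (char_poly C) z = 0" using eigenvalue_root_char_poly[OF C] by simp
  moreover have "char_poly C = map_poly of_int (char_poly B)"
    unfolding C_def by (rule of_int_hom.char_poly_hom[OF B])
  moreover have "lead_coeff (char_poly B) = 1"
    using degree_monic_char_poly[OF B] by simp
  ultimately show ?thesis
    unfolding algebraic_int_altdef_ipoly by metis
qed

text \<open>When \<open>w ^ M = 1\<close> this additive group is the ring generated by
  \<open>w\<close>. The powers of \<open>w\<close> serve as a spanning family only; the coefficients
  need not be unique.\<close>

definition root_span :: "nat \<Rightarrow> complex \<Rightarrow> complex set" where
  "root_span M w = range (\<lambda>c :: nat \<Rightarrow> int. \<Sum>k<M. of_int (c k) * w ^ k)"

lemma root_spanI: "(\<Sum>k<M. of_int (c k) * w ^ k) \<in> root_span M w"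
  unfolding root_span_def by blast

lemma root_span_add:
  assumes "x \<in> root_span M w" "y \<in> root_span M w"
  shows "x + y \<in> root_span M w"
proof -
  obtain c d where "x = (\<Sum>k<M. of_int (c k :: int) * w ^ k)" "y = (\<Sum>k<M. of_int (d k :: int) * w ^ k)"
    using assms unfolding root_span_def by blast
  then have "x + y = (\<Sum>k<M. of_int (c k + d k) * w ^ k)"
    by (simp add: sum.distrib algebra_simps)
  then show ?thesis by (rule ssubst) (rule root_spanI)
qed

lemma root_span_of_int_mult:
  assumes "x \<in> root_span M w"
  shows "of_int n * x \<in> root_span M w"
proof -
  obtain c where "x = (\<Sum>k<M. of_int (c k :: int) * w ^ k)"
    using assms unfolding root_span_def by blast
  then have "of_int n * x = (\<Sum>k<M. of_int (n * c k) * w ^ k)"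
    by (simp add: sum_distrib_left algebra_simps)
  then show ?thesis by (rule ssubst) (rule root_spanI)
qed

lemma root_span_0: "0 \<in> root_span M w"
  unfolding root_span_def by (rule range_eqI[of _ _ "\<lambda>_. 0"]) simp

lemma root_span_sum:
  "(\<And>i. i \<in> I \<Longrightarrow> f i \<in> root_span M w) \<Longrightarrow> sum f I \<in> root_span M w"
  by (induction I rule: infinite_finite_induct) (auto intro: root_span_0 root_span_add)

lemma root_span_power:
  assumes "M > 0" "w ^ M = 1"
  shows "w ^ k \<in> root_span M w"
proof -
  have "w ^ k = w ^ (M * (k div M) + k mod M)" by simp
  also have "\<dots> = w ^ (k mod M)"
    using assms by (simp only: power_add power_mult) simp
  also have "\<dots> = (\<Sum>j<M. if j = k mod M then w ^ j else 0)"
    using assms by simp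
  also have "\<dots> = (\<Sum>j<M. of_int (if j = k mod M then 1 else 0) * w ^ j)"
    by (intro sum.cong) auto
  finally show ?thesis by (rule ssubst) (rule root_spanI)
qed

lemma root_span_mult:
  assumes "M > 0" "w ^ M = 1" "x \<in> root_span M w" "y \<in> root_span M w"
  shows "x * y \<in> root_span M w"
proof -
  obtain c d where *: "x = (\<Sum>k<M. of_int (c k :: int) * w ^ k)" "y = (\<Sum>k<M. of_int (d k :: int) * w ^ k)"
    using assms unfolding root_span_def by blast
  have "x * y = (\<Sum>k<M. \<Sum>l<M. of_int (c k * d l) * w ^ (k + l))"
    unfolding * sum_product by (simp add: power_add mult_ac)
  then show ?thesis
    by (simp only:) (intro root_span_sum root_span_of_int_mult root_span_power assms)
qed

lemma root_span_of_int:
  assumes "M > 0" "w ^ M = 1"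
  shows "of_int n \<in> root_span M w"
  using root_span_of_int_mult[OF root_span_power[OF assms, of 0], of n] by simp

text \<open>Multiplication by \<open>z\<close> sends each power of \<open>w\<close> to an integer
  combination of the first \<open>M\<close> powers, so \<open>z\<close> is an eigenvalue of an
  integer matrix; \<open>w ^ 0 = 1\<close> supplies the nonzero entry of the eigenvector.\<close>

lemma root_span_algebraic_int:
  assumes "M > 0" "w ^ M = 1" "z \<in> root_span M w"
  shows "algebraic_int z"
proof -
  have "z * w ^ i \<in> root_span M w" for i
    by (intro root_span_mult root_span_power assms)
  then have "\<exists>c. z * w ^ i = (\<Sum>k<M. of_int (c k :: int) * w ^ k)" for i
    unfolding root_span_def by blast
  then obtain A where "\<And>i. z * w ^ i = (\<Sum>k<M. of_int (A i k :: int) * w ^ k)" by metis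
  from algebraic_int_integer_matrix[of M z "\<lambda>i. w ^ i" A 0, OF this] assms
  show ?thesis by simp
qed

section \<open>Congruence modulo \<open>p\<close> in a ring where \<open>p\<close> is not
  invertible\<close>

lemma fermat_little_int:
  assumes "prime p"
  shows "[n ^ p = n] (mod int p)"
proof -
  define m where "m = nat (n mod int p)"
  have p: "p > 0" using assms by (rule prime_gt_0_nat)
  have m: "[int m = n] (mod int p)" using p by (simp add: m_def)
  have "[m ^ p = m] (mod p)"
  proof (cases "p dvd m")
    case True
    then have "p dvd m ^ p" using p by (simp add: dvd_power dvd_trans)
    with True show ?thesis by (simp add: cong_def)
  next
    case False
    then have "[m * m ^ (p - 1) = m * 1] (mod p)"
      using assms by (intro cong_scalar_left fermat_theorem)
    then show ?thesis using p by (simp flip: power_Suc)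
  qed
  then have "[int m ^ p = int m] (mod int p)" by (simp flip: cong_int_iff)
  with m show ?thesis by (metis cong_pow cong_sym cong_trans)
qed

text \<open>A subring of the complex numbers containing the integers localised at \<open>p\<close>.
  The axiom \<open>inverse_p\<close> keeps congruence modulo \<open>p\<close> from collapsing:
  through it a congruence between rationals in this ring descends to the integers.\<close>

locale local_ring =
  fixes W :: "complex set" and p :: nat
  assumes prime: "prime p"
    and add: "x \<in> W \<Longrightarrow> y \<in> W \<Longrightarrow> x + y \<in> W"
    and mult: "x \<in> W \<Longrightarrow> y \<in> W \<Longrightarrow> x * y \<in> W"
    and of_int: "of_int n \<in> W"
    and inverse_int: "\<not> int p dvd n \<Longrightarrow> inverse (of_int n) \<in> W"
    and inverse_p: "inverse (of_nat p) \<notin> W"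
begin

lemma of_nat: "of_nat n \<in> W"
  using of_int[of "int n"] by simp

lemma numeral: "numeral k \<in> W" and zero: "0 \<in> W" and one: "1 \<in> W"
  using of_int[of "numeral k"] of_int[of 0] of_int[of 1] by simp_all

lemma minus: "x \<in> W \<Longrightarrow> - x \<in> W"
  using mult[OF of_int[of "-1"]] by simp

lemma diff: "x \<in> W \<Longrightarrow> y \<in> W \<Longrightarrow> x - y \<in> W"
  using add[OF _ minus] by simp

lemma pow: "x \<in> W \<Longrightarrow> x ^ n \<in> W"
  by (induction n) (auto intro: mult one)

lemma sum: "(\<And>i. i \<in> I \<Longrightarrow> f i \<in> W) \<Longrightarrow> sum f I \<in> W"
  by (induction I rule: infinite_finite_induct) (auto intro: add zero)

lemmas closed = of_nat numeral zero one minus diff pow sum of_int add mult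

text \<open>Only the difference has to lie in \<open>p\<close> times \<open>W\<close>;
  \<open>x\<close> and \<open>y\<close> themselves may lie outside, which is why products of
  congruences ask for membership.\<close>

definition eqv :: "complex \<Rightarrow> complex \<Rightarrow> bool" (infix "\<approx>" 50) where
  "x \<approx> y \<longleftrightarrow> (\<exists>w\<in>W. x - y = of_nat p * w)"

lemma eqvI: "w \<in> W \<Longrightarrow> x - y = of_nat p * w \<Longrightarrow> x \<approx> y"
  unfolding eqv_def by blast

lemma eqv_refl [simp]: "x \<approx> x"
  by (rule eqvI[OF zero]) simp

lemma eqv_sym: "x \<approx> y \<Longrightarrow> y \<approx> x"
  unfolding eqv_def by (metis minus minus_diff_eq mult_minus_right)

lemma eqv_trans [trans]: "x \<approx> y \<Longrightarrow> y \<approx> z \<Longrightarrow> x \<approx> z"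
  unfolding eqv_def by (metis add diff_add_cancel add_diff_eq distrib_left)

lemma eqv_add: "x \<approx> y \<Longrightarrow> x' \<approx> y' \<Longrightarrow> x + x' \<approx> y + y'"
  unfolding eqv_def by (metis add add_diff_add distrib_left)

lemma eqv_mult_left: "z \<in> W \<Longrightarrow> x \<approx> y \<Longrightarrow> z * x \<approx> z * y"
  unfolding eqv_def by (metis mult mult.left_commute right_diff_distrib)

lemma eqv_mult_right: "z \<in> W \<Longrightarrow> x \<approx> y \<Longrightarrow> x * z \<approx> y * z"
  using eqv_mult_left[of z x y] by (simp add: mult.commute)

lemma eqv_minus: "x \<approx> y \<Longrightarrow> - x \<approx> - y"
  using eqv_mult_left[OF of_int[of "-1"]] by simp

lemma eqv_diff: "x \<approx> y \<Longrightarrow> x' \<approx> y' \<Longrightarrow> x - x' \<approx> y - y'"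
  using eqv_add[OF _ eqv_minus] by simp

lemma eqv_mult:
  assumes "x \<approx> y" "x' \<approx> y'" "y \<in> W" "x' \<in> W"
  shows "x * x' \<approx> y * y'"
  using eqv_mult_right[OF assms(4,1)] eqv_mult_left[OF assms(3,2)] by (rule eqv_trans)

lemma eqv_sum: "(\<And>i. i \<in> I \<Longrightarrow> f i \<approx> g i) \<Longrightarrow> sum f I \<approx> sum g I"
  by (induction I rule: infinite_finite_induct) (auto intro!: eqv_add)

lemma eqv_cancel:
  assumes "z * x \<approx> z * y" "inverse z \<in> W" "z \<noteq> 0"
  shows "x \<approx> y"
  using eqv_mult_left[OF assms(2,1)] assms(3) by (simp flip: mult.assoc)

lemma eqv_of_int: "[m = n] (mod int p) \<Longrightarrow> of_int m \<approx> of_int n"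
proof -
  assume "[m = n] (mod int p)"
  then obtain k where "m - n = int p * k" by (auto simp: cong_iff_dvd_diff)
  then have "(of_int (m - n) :: complex) = of_nat p * of_int k"
    by (metis of_int_mult of_int_of_nat_eq)
  then show ?thesis by (intro eqvI[OF of_int[of k]]) simp
qed

text \<open>The Frobenius identity: for \<open>0 < k < p\<close> the binomial coefficient is
  divisible by \<open>p\<close>, so only the two extreme terms survive.\<close>

lemma eqv_add_power:
  assumes "x \<in> W" "y \<in> W"
  shows "(x + y) ^ p \<approx> x ^ p + y ^ p"
proof -
  have p: "p > 1" using prime prime_gt_1_nat by blast
  have "(x + y) ^ p = (\<Sum>k\<le>p. of_nat (p choose k) * x ^ k * y ^ (p - k))"
    by (rule binomial_ring)
  also have "\<dots> \<approx> (\<Sum>k\<le>p. if k = 0 then y ^ p else if k = p then x ^ p else 0)"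
  proof (rule eqv_sum)
    fix k assume k: "k \<in> {..p}"
    consider "k = 0" | "k = p" | "0 < k" "k < p" using k by fastforce
    then show "of_nat (p choose k) * x ^ k * y ^ (p - k) \<approx>
        (if k = 0 then y ^ p else if k = p then x ^ p else 0)"
    proof cases
      case 3
      then have "p dvd (p choose k)" using prime by (intro dvd_choose_prime) auto
      then obtain l where "p choose k = p * l" by blast
      with 3 show ?thesis using assms
        by (intro eqvI[of "of_nat l * x ^ k * y ^ (p - k)"] closed) auto
    qed (use p in auto)
  qed
  also have "\<dots> = (\<Sum>k\<in>{0, p}. if k = 0 then y ^ p else x ^ p)"
    by (rule sum.mono_neutral_cong_right) auto
  also have "\<dots> = x ^ p + y ^ p" using p by simp
  finally show ?thesis .
qed

lemma eqv_sum_power: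
  assumes "\<And>i. i \<in> I \<Longrightarrow> f i \<in> W"
  shows "sum f I ^ p \<approx> (\<Sum>i\<in>I. f i ^ p)"
  using assms
proof (induction I rule: infinite_finite_induct)
  case (insert i I)
  have "(f i + sum f I) ^ p \<approx> f i ^ p + sum f I ^ p"
    using insert by (intro eqv_add_power sum) auto
  also have "\<dots> \<approx> f i ^ p + (\<Sum>i\<in>I. f i ^ p)"
    using insert by (intro eqv_add) auto
  finally show ?case using insert by simp
qed (use prime in \<open>simp_all add: prime_gt_0_nat power_0_left\<close>)

lemma eqv_int_power: "of_int n ^ p \<approx> of_int n"
  using eqv_of_int[OF fermat_little_int[OF prime, of n]] by simp

text \<open>The congruence puts \<open>u/p\<close> into \<open>W\<close>, where \<open>u\<close> is
  the numerator of \<open>x - y\<close>. If \<open>p\<close> did not divide \<open>u\<close>, Bezout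
  would write \<open>1/p\<close> as an integer combination of \<open>u/p\<close> and
  \<open>1\<close>, against \<open>inverse_p\<close>.\<close>

lemma rat_cong_modI:
  assumes "of_rat x \<approx> of_rat y"
  shows "int p dvd fst (quotient_of (x - y))"
proof -
  obtain u v where uv: "quotient_of (x - y) = (u, v)" by force
  have v: "v > 0" "coprime u v" "x - y = of_int u / of_int v"
    using quotient_of_denom_pos[OF uv] quotient_of_coprime[OF uv] quotient_of_div[OF uv] by auto
  obtain w where w: "w \<in> W" "of_rat (x - y) = of_nat p * w"
    using assms unfolding eqv_def by (auto simp: of_rat_diff)
  have "of_int u = of_int v * (of_nat p * w)"
    using v(1) w(2) unfolding v(3) by (simp add: of_rat_divide field_simps)
  show ?thesis
  proof (rule ccontr)
    assume "\<not> ?thesis"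
    then have "\<not> int p dvd u" using uv by simp
    then have "coprime (int p) u" using prime by (intro prime_imp_coprime) simp_all
    then have "coprime u (int p)" by (simp only: coprime_commute)
    then obtain s t where st: "s * u + t * int p = 1"
      using bezout_int[of u "int p"] by auto
    have "of_int u / of_nat p = of_int v * w"
      using \<open>of_int u = of_int v * (of_nat p * w)\<close> prime by (auto simp: prime_gt_0_nat)
    have "inverse (of_nat p) = (of_int (s * u + t * int p) :: complex) / of_nat p"
      unfolding st by (simp add: field_simps)
    also have "\<dots> = of_int s * (of_int u / of_nat p) + of_int t"
      using prime by (auto simp: field_simps)
    also have "\<dots> = of_int s * (of_int v * w) + of_int t"
      by (simp only: \<open>of_int u / of_nat p = of_int v * w\<close>)
    also have "\<dots> \<in> W" by (intro closed w)
    finally show False using inverse_p by simp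
  qed
qed

end

text \<open>The localisation of \<open>root_span M w\<close> at \<open>p\<close>: elements that an
  integer denominator prime to \<open>p\<close> clears.\<close>

definition loc_span :: "nat \<Rightarrow> nat \<Rightarrow> complex \<Rightarrow> complex set" where
  "loc_span p M w = {z. \<exists>d. \<not> int p dvd d \<and> of_int d * z \<in> root_span M w}"

lemma root_span_subset_loc_span:
  assumes "prime p"
  shows "root_span M w \<subseteq> loc_span p M w"
proof
  fix z assume "z \<in> root_span M w"
  moreover have "\<not> int p dvd 1" using assms not_prime_unit by auto
  ultimately show "z \<in> loc_span p M w"
    unfolding loc_span_def by (intro CollectI exI[of _ 1]) simp
qed

text \<open>The substantial point is that \<open>1/p\<close> is missing: otherwise some
  \<open>d/p\<close> with \<open>d\<close> prime to \<open>p\<close> would be a rational algebraic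
  integer, hence an integer.\<close>

lemma local_ring_loc_span:
  assumes p: "prime p" and w: "M > 0" "w ^ M = 1"
  shows "local_ring (loc_span p M w) p"
proof
  have pp: "prime (int p)" using p by simp
  show "prime p" by fact
  show int: "of_int n \<in> loc_span p M w" for n
    using root_span_subset_loc_span[OF p] root_span_of_int[OF w] by blast
  fix x y assume "x \<in> loc_span p M w" "y \<in> loc_span p M w"
  then obtain d e where d: "\<not> int p dvd d" "of_int d * x \<in> root_span M w"
    and e: "\<not> int p dvd e" "of_int e * y \<in> root_span M w"
    unfolding loc_span_def by blast
  have de: "\<not> int p dvd d * e" using d e pp by (simp add: prime_dvd_mult_iff)
  have "of_int (d * e) * (x + y) = of_int e * (of_int d * x) + of_int d * (of_int e * y)"
    by (simp add: algebra_simps)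
  also have "\<dots> \<in> root_span M w"
    by (rule root_span_add[OF root_span_of_int_mult[OF d(2)] root_span_of_int_mult[OF e(2)]])
  finally show "x + y \<in> loc_span p M w" using de unfolding loc_span_def by blast
  have "of_int (d * e) * (x * y) = (of_int d * x) * (of_int e * y)"
    by (simp add: algebra_simps)
  also have "\<dots> \<in> root_span M w"
    by (rule root_span_mult[OF w d(2) e(2)])
  finally show "x * y \<in> loc_span p M w" using de unfolding loc_span_def by blast
next
  fix n assume n: "\<not> int p dvd n"
  then have "n \<noteq> 0" by auto
  then have "of_int n * inverse (of_int n) = (of_int 1 :: complex)" by simp
  also have "\<dots> \<in> root_span M w" by (rule root_span_of_int[OF w])
  finally show "inverse (of_int n) \<in> loc_span p M w"
    using n unfolding loc_span_def by blast
next
  show "inverse (of_nat p) \<notin> loc_span p M w"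
  proof
    assume "inverse (of_nat p) \<in> loc_span p M w"
    then obtain d where d: "\<not> int p dvd d" "of_int d * inverse (of_nat p) \<in> root_span M w"
      unfolding loc_span_def by blast
    then have "algebraic_int (of_int d * inverse (of_nat p) :: complex)"
      using root_span_algebraic_int[OF w] by blast
    then have "of_int d * inverse (of_nat p) \<in> (\<int> :: complex set)"
      by (rule rational_algebraic_int_is_int) simp
    then obtain k where "of_int d * inverse (of_nat p) = (of_int k :: complex)"
      by (auto elim: Ints_cases)
    then have "(of_int d :: complex) = of_int (k * int p)"
      using p prime_gt_0_nat by (auto simp: field_simps)
    then have "d = k * int p" by (simp only: of_int_eq_iff)
    with d show False by simp
  qed
qed

section \<open>Congruences modulo an odd prime\<close>

context local_ring
begin

lemma eqv_inverse:
  assumes "x \<approx> y" "inverse x \<in> W" "inverse y \<in> W" "x \<noteq> 0" "y \<noteq> 0"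
  shows "inverse x \<approx> inverse y"
proof -
  have "inverse x * inverse y * x \<approx> inverse x * inverse y * y"
    using assms by (intro eqv_mult_left mult)
  then have "inverse y \<approx> inverse x" using assms by (simp add: mult.assoc mult.left_commute[of "inverse x"])
  then show ?thesis by (rule eqv_sym)
qed

lemma odd_not_dvd_2: "odd p \<Longrightarrow> \<not> int p dvd 2"
  using prime by (metis int_dvd_int_iff of_nat_numeral primes_dvd_imp_eq two_is_prime_nat even_numeral)

text \<open>Put \<open>F = b + a\<i>\<close>. Since \<open>r\<^sup>2 = a\<^sup>2 + b\<^sup>2\<close>, one has
  \<open>(F + r)\<^sup>2 = 2F(r + b)\<close> and \<open>(F - r)\<^sup>2 = -2F(r - b)\<close>. Hence the \<open>n\<close>-th powers of
  \<open>1 \<plusminus> b/r\<close> are, up to explicit factors, \<open>(p - 1)\<close>-th powers of \<open>F \<plusminus> r\<close>, to which the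
  Frobenius map applies.\<close>

lemma half_sum_powers_eqv:
  fixes a b :: int and q n :: nat and r c s :: complex
  defines "\<pi> \<equiv> of_int a + of_int b * \<i>"
  assumes ii: "\<i> \<in> W" and r: "r \<in> W" "r ^ 2 = of_nat q" and q: "int q = a ^ 2 + b ^ 2"
    and p: "p = 2 * n + 1" and pa: "\<not> int p dvd a" and pq: "\<not> int p dvd int q"
    and c: "c \<in> W" and c4: "c ^ 2 = 1 \<or> c ^ 2 = - 1" and s: "s \<in> W"
    and rp: "r ^ p \<approx> c ^ 2 * r"
    and even: "even n \<Longrightarrow> c * (\<pi> * r) ^ n \<approx> 1"
    and odd: "odd n \<Longrightarrow> (\<pi> * r) ^ (n + 1) \<approx> c * s * of_nat q"
  shows "((1 + of_int b / r) ^ n + (1 - of_int b / r) ^ n) / 2 \<approx>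
    (if even n then 1 else s) * c * (if c ^ 2 = 1 then 1 else \<i> * of_int b / of_int a)"
proof -
  \<comment> \<open>In the application \<open>c\<close> is the quartic character at
    \<open>p\<close>, \<open>s\<close> is its value at \<open>-1\<close>, and
    \<open>\<pi> * r\<close> is the square of the quartic Gauss sum; the hypotheses
    \<open>even\<close> and \<open>odd\<close> express the Frobenius image of that sum.\<close>
  define A B Q where "A = (of_int a :: complex)" and "B = (of_int b :: complex)"
    and "Q = (of_nat q :: complex)"
  define F where "F = B + A * \<i>"
  define Ab where "Ab = A - B * \<i>"
  define D D' where "D = F + r" and "D' = F - r"
  define t where "t = (2 * \<i>) ^ n"
  have \<pi>: "\<pi> = A + B * \<i>" by (simp add: \<pi>_def A_def B_def)
  have ABW [simp]: "A \<in> W" "B \<in> W" "Q \<in> W" by (auto simp: A_def B_def Q_def intro: closed)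
  have FW [simp]: "F \<in> W" "D \<in> W" "D' \<in> W" "\<pi> \<in> W" "t \<in> W"
    using ii r by (auto simp: F_def D_def D'_def \<pi> t_def intro!: closed)
  have "(of_int (int q) :: complex) = of_int (a ^ 2 + b ^ 2)" using q by simp
  then have Q: "Q = A ^ 2 + B ^ 2" by (simp add: Q_def A_def B_def)
  have nz: "A \<noteq> 0" "Q \<noteq> 0" "r \<noteq> 0"
    using pa pq r by (auto simp: A_def Q_def intro!: Nat.gr0I)
  have Q\<pi>: "Q = \<pi> * Ab" unfolding Q \<pi> Ab_def by (simp add: algebra_simps power2_eq_square)
  have F: "F = \<i> * Ab" by (simp add: F_def Ab_def algebra_simps)
  have r2: "r * r = Q" using r by (simp add: Q_def power2_eq_square)
  have nz': "\<pi> \<noteq> 0" "Ab \<noteq> 0" "F \<noteq> 0" using nz Q\<pi> F by auto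
  have DD: "D * D' = - 2 * A * Ab"
  proof -
    have "D * D' = F * F - r * r" by (simp add: D_def D'_def algebra_simps)
    then show ?thesis unfolding r2 F Q\<pi> \<pi> Ab_def by (simp add: algebra_simps)
  qed
  with nz nz' have D0: "D \<noteq> 0" "D' \<noteq> 0" by auto
  have D2: "D ^ 2 = 2 * F * (r + B)" "D' ^ 2 = - (2 * F * (r - B))"
  proof -
    have *: "F * F + r * r = 2 * F * B"
      unfolding r2 F Q\<pi> \<pi> Ab_def by (simp add: algebra_simps)
    have "D ^ 2 = F * F + r * r + 2 * F * r" "D' ^ 2 = F * F + r * r - 2 * F * r"
      by (simp_all add: D_def D'_def power2_eq_square algebra_simps)
    then show "D ^ 2 = 2 * F * (r + B)" "D' ^ 2 = - (2 * F * (r - B))"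
      unfolding * by (simp_all add: algebra_simps)
  qed
  \<comment> \<open>Since \<open>p - 1 = 2 * n\<close>, the powers \<open>(D ^ 2) ^ n\<close> and
    \<open>(D' ^ 2) ^ n\<close> are \<open>D ^ p / D\<close> and \<open>D' ^ p / D'\<close>;
    \<open>X\<close> is the numerator over the common denominator.\<close>
  define X where "X = D ^ p * D' + (- 1) ^ n * D' ^ p * D"
  have uv: "(1 + B / r) ^ n = D ^ p / (D * (2 * F * r) ^ n)"
    "(1 - B / r) ^ n = (- 1) ^ n * D' ^ p / (D' * (2 * F * r) ^ n)"
  proof -
    have "1 + B / r = D ^ 2 / (2 * F * r)" "1 - B / r = - (D' ^ 2) / (2 * F * r)"
      unfolding D2 using nz nz' by (simp_all add: field_simps)
    then show "(1 + B / r) ^ n = D ^ p / (D * (2 * F * r) ^ n)"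
      "(1 - B / r) ^ n = (- 1) ^ n * D' ^ p / (D' * (2 * F * r) ^ n)"
      unfolding p using D0
      by (simp_all add: power_divide power_mult power_minus[of "_ / _"] power_minus[of "_ ^ 2"])
  qed
  \<comment> \<open>The denominator involves \<open>F * r\<close>, the hypotheses
    \<open>\<pi> * r\<close>. The relation \<open>F * \<pi> = \<i> * Q\<close> connects the two and
    leaves only \<open>t\<close> and a power of \<open>Q\<close>.\<close>
  have FQ: "(2 * F * r) ^ n * (\<pi> * r) ^ n = t * Q ^ (2 * n)"
  proof -
    have "(2 * F * r) * (\<pi> * r) = (2 * \<i>) * Q ^ 2"
      by (simp add: F Q\<pi> r2[symmetric, unfolded Q\<pi>] power2_eq_square)
        (metis (no_types) Q\<pi> mult.assoc mult.commute r2)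
    then have "((2 * F * r) * (\<pi> * r)) ^ n = ((2 * \<i>) * Q ^ 2) ^ n" by (simp only:)
    then show ?thesis by (simp only: t_def power_mult power_mult_distrib)
  qed
  have "((1 + B / r) ^ n + (1 - B / r) ^ n) / 2 = X / (2 * (D * D') * (2 * F * r) ^ n)"
    unfolding uv X_def using D0 nz nz' by (simp add: field_simps)
  also have "\<dots> = X * (\<pi> * r) ^ n / (2 * (D * D') * ((2 * F * r) ^ n * (\<pi> * r) ^ n))"
    using nz nz' by (simp only: mult.assoc[symmetric] nonzero_mult_divide_mult_cancel_right
      power_not_zero mult_eq_0_iff simp_thms)
  also have "\<dots> = X * (\<pi> * r) ^ n / (2 * (D * D') * (t * Q ^ (2 * n)))"
    unfolding FQ ..
  also have "\<dots> = X * ((\<pi> * r) ^ n * \<pi> * inverse (- 4 * A * Q) * inverse (t * Q ^ (2 * n)))"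
  proof -
    have "inverse (2 * (- 2 * A * Ab)) = \<pi> * inverse (- 4 * A * Q)"
      unfolding Q\<pi> using nz nz' by (simp add: field_simps)
    then show ?thesis unfolding DD divide_inverse inverse_mult_distrib[of "2 * (- 2 * A * Ab)"]
      by (simp only: mult_ac)
  qed
  finally have eq: "((1 + B / r) ^ n + (1 - B / r) ^ n) / 2 =
      X * ((\<pi> * r) ^ n * \<pi> * inverse (- 4 * A * Q) * inverse (t * Q ^ (2 * n)))" .

  have odd_p: "odd p" by (simp add: p)
  then have p2: "\<not> int p dvd 2" by (rule odd_not_dvd_2)
  have inv2: "inverse 2 \<in> W" using inverse_int[OF p2] by simp
  have invA: "inverse A \<in> W" unfolding A_def by (rule inverse_int[OF pa])
  have invQ: "inverse Q \<in> W" unfolding Q_def using inverse_int[OF pq] by simp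
  have invt: "inverse t \<in> W"
  proof -
    have "inverse (2 * \<i>) = - \<i> * inverse 2" by simp
    then have "inverse t = (- \<i> * inverse 2) ^ n"
      by (simp only: t_def power_inverse[symmetric])
    also have "\<dots> \<in> W" using ii inv2 by (intro pow mult minus)
    finally show ?thesis .
  qed
  have inv4: "inverse (- 4 * A * Q) \<in> W"
  proof -
    have "inverse (- 4 * A * Q) = - (inverse 2 * inverse 2) * inverse A * inverse Q" by simp
    also have "\<dots> \<in> W" using inv2 invA invQ by (intro mult minus)
    finally show ?thesis .
  qed
  have Qp: "Q ^ (2 * n) \<approx> 1"
  proof (rule eqv_cancel[OF _ invQ nz(2)])
    show "Q * Q ^ (2 * n) \<approx> Q * 1"
      using eqv_int_power[of "int q"] by (simp add: p Q_def)
  qed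
  have ip: "\<i> ^ p = (if even n then \<i> else - \<i>)"
    by (auto simp: p power_mult elim: evenE oddE)
  \<comment> \<open>As \<open>(1 + \<i>) ^ 2 = 2 * \<i>\<close>, the product
    \<open>(1 + \<i>) * t\<close> is a \<open>p\<close>-th power, and Frobenius evaluates
    it.\<close>
  have tp: "t \<approx> (if even n then 1 else - \<i>)"
  proof (rule eqv_cancel[of "1 + \<i>"])
    have "(1 + \<i>) ^ 2 = 2 * \<i>" by (simp add: power2_eq_square algebra_simps)
    then have "(1 + \<i>) * t = (1 + \<i>) ^ p"
      by (simp add: p t_def power_mult)
    also have "\<dots> \<approx> 1 ^ p + \<i> ^ p" by (intro eqv_add_power one ii)
    also have "1 ^ p + \<i> ^ p = (1 + \<i>) * (if even n then 1 else - \<i>)"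
      by (simp add: ip algebra_simps)
    finally show "(1 + \<i>) * t \<approx> (1 + \<i>) * (if even n then 1 else - \<i>)" .
    have "inverse (1 + \<i>) = (1 - \<i>) * inverse 2"
      by (rule inverse_unique) (simp add: algebra_simps)
    then show "inverse (1 + \<i>) \<in> W" using mult[OF diff[OF one ii] inv2] by (simp only:)
    show "1 + \<i> \<noteq> 0" by (simp add: complex_eq_iff)
  qed
  have "t * Q ^ (2 * n) \<approx> (if even n then 1 else - \<i>) * 1"
    using tp Qp ii by (intro eqv_mult pow) (auto intro: closed)
  moreover have invtQ: "inverse (t * Q ^ (2 * n)) \<in> W"
    using mult[OF invt pow[OF invQ, of "2 * n"]] by (simp only: inverse_mult_distrib power_inverse)
  ultimately have tQ: "inverse (t * Q ^ (2 * n)) \<approx> inverse ((if even n then 1 else - \<i>) * 1)"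
  proof (rule eqv_inverse)
    show "inverse ((if even n then 1 else - \<i>) * 1) \<in> W" using ii by (auto intro: closed)
    show "t * Q ^ (2 * n) \<noteq> 0" using nz by (simp add: t_def)
  qed auto
  \<comment> \<open>The Frobenius image of \<open>F\<close>: it is \<open>F\<close> itself for
    \<open>p\<close> congruent to 1 modulo 4, and the complex conjugate of \<open>F\<close>
    otherwise.\<close>
  define E where "E = B + A * (if even n then \<i> else - \<i>)"
  have Fp: "F ^ p \<approx> E"
  proof -
    have "F ^ p \<approx> B ^ p + (A * \<i>) ^ p" unfolding F_def using ii by (intro eqv_add_power mult) auto
    also have "\<dots> \<approx> E" unfolding power_mult_distrib ip E_def A_def B_def
      using ii by (intro eqv_add eqv_mult_right eqv_int_power) (auto intro: closed)
    finally show ?thesis .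
  qed
  define e where "e = c ^ 2"
  have eW: "e \<in> W" unfolding e_def using c by (intro pow)
  have EW: "E \<in> W" unfolding E_def using ii by (auto intro!: closed)
  have Dp: "D ^ p \<approx> E + e * r" "D' ^ p \<approx> E - e * r"
  proof -
    have "D ^ p \<approx> F ^ p + r ^ p" unfolding D_def using r by (intro eqv_add_power) auto
    also have "\<dots> \<approx> E + e * r" unfolding e_def by (intro eqv_add Fp rp)
    finally show "D ^ p \<approx> E + e * r" .
    have "D' ^ p \<approx> F ^ p + (- r) ^ p"
      unfolding D'_def diff_conv_add_uminus using r by (intro eqv_add_power minus) auto
    also have "\<dots> = F ^ p - r ^ p" using odd_p by simp
    also have "\<dots> \<approx> E - e * r" unfolding e_def by (intro eqv_diff Fp rp)
    finally show "D' ^ p \<approx> E - e * r" .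
  qed
  define Y where "Y = (E + e * r) * D' + (- 1) ^ n * (E - e * r) * D"
  have XY: "X \<approx> Y" unfolding X_def Y_def
    using r eW by (intro eqv_add eqv_mult_right eqv_mult_left Dp) (auto intro!: closed)
  define Z where "Z = inverse ((if even n then 1 else - \<i>) * 1 :: complex)"
  have ZW: "Z \<in> W" unfolding Z_def using ii by (auto intro: closed)
  have "((1 + B / r) ^ n + (1 - B / r) ^ n) / 2 \<approx>
      Y * ((\<pi> * r) ^ n * \<pi> * inverse (- 4 * A * Q) * Z)"
    unfolding eq Z_def
    using XY tQ inv4 r eW EW invtQ FW
    by (intro eqv_mult eqv_mult_left mult pow) (auto simp: Y_def intro!: closed)
  also have "\<dots> \<approx> (if even n then 1 else s) * c * (if e = 1 then 1 else \<i> * B / A)"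
  proof (cases "even n")
    case True
    have e2: "e = 1 \<or> e = -1" using c4 by (simp add: e_def)
    have ce: "c * c = e" by (simp add: e_def power2_eq_square)
    have EF: "E = F" using True by (simp add: E_def F_def)
    have Z: "Z = 1" using True by (simp add: Z_def)
    \<comment> \<open>Since \<open>c * c = e\<close> and \<open>e * e = 1\<close>, the inverse of
      \<open>c\<close> is \<open>e * c\<close>; this solves the hypothesis \<open>even\<close> for
      the power of \<open>\<pi> * r\<close>.\<close>
    have "e * (c * (c * (\<pi> * r) ^ n)) = (e * e) * (\<pi> * r) ^ n"
      using ce by (metis mult.assoc)
    moreover have "e * (c * (c * (\<pi> * r) ^ n)) \<approx> e * (c * 1)"
      using even[OF True] eW c by (intro eqv_mult_left)
    moreover have "e * e = 1" using e2 by auto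
    ultimately have main: "(\<pi> * r) ^ n \<approx> e * c" by (simp only: mult_1_left mult_1_right)
    \<comment> \<open>The sign of the second case is opposite to the one in the claim; the factor
      \<open>e\<close> of \<open>main\<close> reverses it.\<close>
    define T where "T = (if e = 1 then 1 else - \<i> * B / A)"
    have "Y * \<pi> = - 4 * A * Q * T"
    proof (cases "e = 1")
      case True': True
      have "Y = 2 * (D * D')" unfolding Y_def EF using True True' by (simp add: D_def D'_def algebra_simps)
      then show ?thesis unfolding DD Q\<pi> T_def using True' by simp
    next
      case False
      then have "e = -1" using e2 by auto
      have "Y = 2 * (F * F + r * r)"
        unfolding Y_def EF using True \<open>e = -1\<close> by (simp add: D_def D'_def algebra_simps)
      also have "\<dots> = 4 * B * F" unfolding r2 F Q\<pi> \<pi> Ab_def by (simp add: algebra_simps)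
      finally show ?thesis unfolding T_def Q\<pi> F using False nz by (simp add: field_simps)
    qed
    moreover have "Y * ((\<pi> * r) ^ n * \<pi> * inverse (- 4 * A * Q) * Z) =
        (Y * \<pi>) * inverse (- 4 * A * Q) * (\<pi> * r) ^ n"
      unfolding Z by (simp only: mult_ac mult_1_left mult_1_right)
    moreover have "- 4 * A * Q * T * inverse (- 4 * A * Q) = T"
      using nz by (simp add: field_simps)
    ultimately have "Y * ((\<pi> * r) ^ n * \<pi> * inverse (- 4 * A * Q) * Z) = T * (\<pi> * r) ^ n"
      by (simp only:)
    also have "\<dots> \<approx> T * (e * c)"
      using main ii invA unfolding T_def
      by (intro eqv_mult_left) (auto simp: divide_inverse intro!: closed)
    also have "T * (e * c) = c * (if e = 1 then 1 else \<i> * B / A)"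
      using e2 by (auto simp: T_def)
    finally show ?thesis using True by simp
  next
    case False
    have e2: "e = 1 \<or> e = -1" using c4 by (simp add: e_def)
    have Z: "Z = \<i>" using False by (simp add: Z_def)
    define T where "T = (if e = 1 then 1 else \<i> * B / A)"
    \<comment> \<open>Here \<open>E\<close> is the conjugate of \<open>F\<close>, so
      \<open>e * F - E\<close> is \<open>2 * \<i> * A\<close> for \<open>e = 1\<close> and
      \<open>- 2 * B\<close> for \<open>e = -1\<close>.\<close>
    have "Y = 2 * r * (e * F - E)"
      unfolding Y_def using False by (simp add: D_def D'_def algebra_simps)
    also have "\<dots> = 4 * \<i> * A * r * T"
      using e2 False nz by (auto simp: E_def F_def T_def field_simps)
    finally have Y: "Y = 4 * \<i> * A * r * T" .
    have "Y * ((\<pi> * r) ^ n * \<pi> * inverse (- 4 * A * Q) * Z) =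
        (T * inverse Q) * (\<pi> * r) ^ (n + 1)"
    proof -
      have "4 * \<i> * A * r * T * (\<pi> * inverse (- 4 * A * Q) * \<i>) = T * inverse Q * (\<pi> * r)"
        using nz by (simp add: field_simps)
      moreover have "Y * ((\<pi> * r) ^ n * \<pi> * inverse (- 4 * A * Q) * Z) =
          Y * (\<pi> * inverse (- 4 * A * Q) * \<i>) * (\<pi> * r) ^ n"
        unfolding Z by (simp only: mult_ac)
      ultimately show ?thesis unfolding Y by (simp only: mult_ac power_Suc Suc_eq_plus1[symmetric])
    qed
    also have "\<dots> \<approx> (T * inverse Q) * (c * s * Q)"
      using odd[OF False] ii invA invQ unfolding T_def Q_def
      by (intro eqv_mult_left) (auto simp: divide_inverse Q_def intro!: closed)
    also have "\<dots> = s * c * T" using nz by simp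
    finally show ?thesis using False by (simp add: T_def)
  qed
  finally show ?thesis unfolding A_def B_def e_def .
qed

text \<open>Passing from \<open>j\<close> to \<open>j + 1\<close> multiplies the two binomial
  coefficients by \<open>2 * (2 * j + 1) / (j + 1)\<close> and \<open>(n - j) / (j + 1)\<close>. The
  numerators satisfy \<open>2 * (2 * j + 1) + 4 * (n - j) = 2 * p\<close>, and \<open>j + 1\<close>
  is invertible because it is below \<open>p\<close>.\<close>

lemma central_binomial_eqv:
  assumes p: "p = 2 * n + 1" and j: "j \<le> n"
  shows "of_nat (2 * j choose j) \<approx> (- 4) ^ j * of_nat (n choose j)"
  using j
proof (induction j)
  case (Suc j)
  have jn: "j < n" using Suc.prems by simp
  have 1: "Suc j * (2 * Suc j choose Suc j) = 2 * (2 * j + 1) * (2 * j choose j)"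
  proof -
    have "(2 * Suc j choose Suc j) = 2 * (Suc (2 * j) choose Suc j)"
      using binomial_symmetric[of j "Suc (2 * j)"] by simp
    then have "Suc j * (2 * Suc j choose Suc j) = 2 * (Suc j * (Suc (2 * j) choose Suc j))"
      by (simp only: mult_ac)
    then show ?thesis unfolding Suc_times_binomial by simp
  qed
  have 2: "Suc j * (n choose Suc j) = (n - j) * (n choose j)"
    using binomial_absorption[of j n] binomial_absorb_comp[of n j] by simp
  have "\<not> int p dvd int (Suc j)" using jn p by (auto dest!: zdvd_imp_le)
  then have inv: "inverse (of_nat (Suc j)) \<in> W" using inverse_int[of "int (Suc j)"] by simp
  have "of_nat (Suc j) * of_nat (2 * Suc j choose Suc j) =
      of_nat (2 * (2 * j + 1)) * (of_nat (2 * j choose j) :: complex)"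
    using 1 by (simp only: flip: of_nat_mult)
  also have "\<dots> \<approx> of_nat (2 * (2 * j + 1)) * ((- 4) ^ j * of_nat (n choose j))"
    using Suc jn by (intro eqv_mult_left of_nat) simp
  also have "\<dots> \<approx> (- 4 * of_nat (n - j)) * ((- 4) ^ j * of_nat (n choose j))"
  proof (rule eqv_mult_right)
    show "of_nat (2 * (2 * j + 1)) \<approx> - 4 * of_nat (n - j)"
      using jn by (intro eqvI[of 2] numeral) (simp add: p of_nat_diff algebra_simps)
  qed (intro closed)
  also have "\<dots> = (- 4) ^ Suc j * of_nat (Suc j * (n choose Suc j))"
    unfolding 2 by simp
  also have "\<dots> = of_nat (Suc j) * ((- 4) ^ Suc j * of_nat (n choose Suc j))"
    by (simp only: of_nat_mult mult_ac)
  finally show ?case using inv by (rule eqv_cancel) (simp only: of_nat_eq_0_iff nat.simps simp_thms)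
qed simp

lemma half_sum_powers_binomial:
  fixes x :: complex
  shows "((1 + x) ^ n + (1 - x) ^ n) / 2 = (\<Sum>k\<le>n div 2. of_nat (n choose (2 * k)) * x ^ (2 * k))"
proof -
  have "((1 + x) ^ n + (1 - x) ^ n) / 2 =
      ((\<Sum>k\<le>n. of_nat (n choose k) * x ^ k) + (\<Sum>k\<le>n. of_nat (n choose k) * (- x) ^ k)) / 2"
    using binomial_ring[of x 1 n] binomial_ring[of "- x" 1 n] by (simp add: add.commute)
  also have "\<dots> = (\<Sum>k\<le>n. if even k then of_nat (n choose k) * x ^ k else 0)"
    unfolding sum.distrib[symmetric] sum_divide_distrib by (intro sum.cong) auto
  also have "\<dots> = (\<Sum>k\<in>(*) 2 ` {..n div 2}. of_nat (n choose k) * x ^ k)"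
    by (rule sum.mono_neutral_cong_right) (auto elim!: evenE)
  also have "\<dots> = (\<Sum>k\<le>n div 2. of_nat (n choose (2 * k)) * x ^ (2 * k))"
    by (subst sum.reindex) (auto simp: inj_on_def)
  finally show ?thesis .
qed

text \<open>At the even index \<open>2 * k\<close> the factor \<open>(- 4) ^ (2 * k)\<close> cancels
  the \<open>k\<close>-th power of 16. Only even powers of \<open>x\<close> occur, so it is the
  square of \<open>x\<close> that has to lie in \<open>W\<close>.\<close>

lemma sum_central_binomial_eqv:
  assumes p: "p = 2 * n + 1" and x: "x\<^sup>2 \<in> W"
  shows "(\<Sum>k = 0..p div 4. of_nat ((4 * k) choose (2 * k)) * (x\<^sup>2 / 16) ^ k) \<approx>
    ((1 + x) ^ n + (1 - x) ^ n) / 2"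
proof -
  have "\<not> int p dvd 2" by (rule odd_not_dvd_2) (simp add: p)
  from inverse_int[OF this] have inv2: "inverse 2 \<in> W" by simp
  have "x\<^sup>2 / 16 = x\<^sup>2 * inverse 2 ^ 4" by (simp add: power_divide)
  then have x16: "x\<^sup>2 / 16 \<in> W" using mult[OF x pow[OF inv2, of 4]] by (simp only:)
  have "of_nat ((4 * k) choose (2 * k)) * (x\<^sup>2 / 16) ^ k \<approx>
      of_nat (n choose (2 * k)) * x ^ (2 * k)" if "k \<le> n div 2" for k
  proof -
    have "of_nat (2 * (2 * k) choose (2 * k)) * (x\<^sup>2 / 16) ^ k \<approx>
        (- 4) ^ (2 * k) * of_nat (n choose (2 * k)) * (x\<^sup>2 / 16) ^ k"
      using that by (intro eqv_mult_right central_binomial_eqv p pow x16) simp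
    also have "\<dots> = of_nat (n choose (2 * k)) * x ^ (2 * k)"
      by (simp add: power_mult power_divide)
    finally show ?thesis by simp
  qed
  moreover have "{0..p div 4} = {..n div 2}" by (auto simp: p)
  ultimately show ?thesis unfolding half_sum_powers_binomial by (auto intro!: eqv_sum)
qed

end

section \<open>Gauss and Jacobi sums\<close>

definition mod_periodic :: "nat \<Rightarrow> (int \<Rightarrow> 'a) \<Rightarrow> bool" where
  "mod_periodic q f \<longleftrightarrow> (\<forall>x. f (x mod int q) = f x)"

lemma mod_periodicD:
  assumes "mod_periodic q f" "[x = y] (mod int q)"
  shows "f x = f y"
  using assms unfolding mod_periodic_def cong_def by metis

lemma sum_mod_periodic_reindex:
  fixes f :: "int \<Rightarrow> 'a :: comm_monoid_add"
  assumes q: "q > 0" and f: "mod_periodic q f"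
    and inj: "\<And>x y. [h x = h y] (mod int q) \<Longrightarrow> [x = y] (mod int q)"
  shows "(\<Sum>x\<in>{0..<int q}. f (h x)) = (\<Sum>x\<in>{0..<int q}. f x)"
proof -
  have "inj_on (\<lambda>x. h x mod int q) {0..<int q}"
  proof (rule inj_onI)
    fix x y assume xy: "x \<in> {0..<int q}" "y \<in> {0..<int q}" "h x mod int q = h y mod int q"
    then have "[x = y] (mod int q)" by (intro inj[of x y]) (simp only: cong_def)
    with xy show "x = y" by (simp add: cong_def)
  qed
  moreover have "(\<lambda>x. h x mod int q) ` {0..<int q} \<subseteq> {0..<int q}" using q by auto
  ultimately have "(\<lambda>x. h x mod int q) ` {0..<int q} = {0..<int q}"
    by (intro endo_inj_surj) auto
  then have "(\<Sum>x\<in>{0..<int q}. f x) = (\<Sum>x\<in>{0..<int q}. f (h x mod int q))"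
    using sum.reindex[OF \<open>inj_on _ _\<close>, of f] by simp
  then show ?thesis using f by (simp add: mod_periodic_def)
qed

lemma sum_mod_periodic_shift:
  fixes f :: "int \<Rightarrow> 'a :: comm_monoid_add"
  assumes "q > 0" "mod_periodic q f"
  shows "(\<Sum>x\<in>{0..<int q}. f (x + t)) = (\<Sum>x\<in>{0..<int q}. f x)"
  using assms by (intro sum_mod_periodic_reindex) (auto simp: cong_add_rcancel)

lemma sum_mod_periodic_scale:
  fixes f :: "int \<Rightarrow> 'a :: comm_monoid_add"
  assumes "prime q" "mod_periodic q f" "\<not> int q dvd t"
  shows "(\<Sum>x\<in>{0..<int q}. f (t * x)) = (\<Sum>x\<in>{0..<int q}. f x)"
proof (rule sum_mod_periodic_reindex)
  have "coprime (int q) t" using assms by (intro prime_imp_coprime) auto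
  then show "[t * x = t * y] (mod int q) \<Longrightarrow> [x = y] (mod int q)" for x y
    by (simp add: cong_mult_lcancel coprime_commute)
qed (use assms prime_gt_0_nat in auto)

section \<open>The additive character modulo \<open>q\<close>\<close>

definition root_char :: "nat \<Rightarrow> int \<Rightarrow> complex" where
  "root_char q x = cis (2 * pi * of_int x / of_nat q)"

lemma root_char_add: "root_char q (x + y) = root_char q x * root_char q y"
  by (simp add: root_char_def cis_mult add_divide_distrib algebra_simps)

lemma root_char_0 [simp]: "root_char q 0 = 1"
  by (simp add: root_char_def)

lemma root_char_nat: "root_char q (int k) = root_char q 1 ^ k"
  by (induction k) (simp_all add: root_char_add)

lemma root_char_eq_1:
  assumes "q > 0"
  shows "root_char q x = 1 \<longleftrightarrow> int q dvd x"
proof -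
  have "root_char q x = 1 \<longleftrightarrow> (\<exists>n::int. 2 * pi * of_int x / of_nat q = of_int n * 2 * pi)"
  proof
    assume "root_char q x = 1"
    then have "cos (2 * pi * of_int x / of_nat q) = 1"
      unfolding root_char_def by (metis cis.sel(1) one_complex.sel(1))
    then show "\<exists>n::int. 2 * pi * of_int x / of_nat q = of_int n * 2 * pi"
      unfolding cos_one_2pi_int .
  next
    assume "\<exists>n::int. 2 * pi * of_int x / of_nat q = of_int n * 2 * pi"
    then obtain n :: int where "2 * pi * of_int x / of_nat q = of_int n * 2 * pi" ..
    then have "root_char q x = cis (2 * pi * of_int n)"
      unfolding root_char_def by (simp only: mult_ac)
    then show "root_char q x = 1" by simp
  qed
  also have "\<dots> \<longleftrightarrow> (\<exists>n::int. of_int x = (of_int (n * int q) :: real))"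
    using assms by (intro ex_cong1) (simp add: field_simps)
  also have "\<dots> \<longleftrightarrow> int q dvd x" unfolding of_int_eq_iff dvd_def by (auto simp: mult.commute)
  finally show ?thesis .
qed

lemma mod_periodic_root_char:
  assumes "q > 0"
  shows "mod_periodic q (root_char q)"
  unfolding mod_periodic_def
proof
  fix x :: int
  have "root_char q x = root_char q (x mod int q) * root_char q (int q * (x div int q))"
    unfolding root_char_add[symmetric] by simp
  also have "root_char q (int q * (x div int q)) = 1" using root_char_eq_1[OF assms] by simp
  finally show "root_char q (x mod int q) = root_char q x" by simp
qed

lemma sum_root_char:
  assumes "q > 1"
  shows "(\<Sum>x\<in>{0..<int q}. root_char q x) = 0"
proof -
  have "(\<Sum>x\<in>{0..<int q}. root_char q x) = (\<Sum>x\<in>{0..<int q}. root_char q (x + 1))"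
    using assms by (intro sum_mod_periodic_shift[symmetric] mod_periodic_root_char) auto
  also have "\<dots> = root_char q 1 * (\<Sum>x\<in>{0..<int q}. root_char q x)"
    by (simp add: root_char_add sum_distrib_left mult.commute)
  finally show ?thesis using root_char_eq_1[of q 1] assms by auto
qed

text \<open>A nontrivial multiplicative character modulo a prime, extended by zero. The axiom
  \<open>unit\<close> makes complex conjugation the inverse on units.\<close>

locale residue_char =
  fixes q :: nat and f :: "int \<Rightarrow> complex"
  assumes prime_q: "prime q"
    and periodic: "mod_periodic q f"
    and mult: "f (x * y) = f x * f y"
    and zero: "int q dvd x \<Longrightarrow> f x = 0"
    and unit: "\<not> int q dvd x \<Longrightarrow> f x * cnj (f x) = 1"
    and nontrivial: "\<exists>x. \<not> int q dvd x \<and> f x \<noteq> 1"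
begin

lemma q_gt_1: "q > 1"
  using prime_q by (rule prime_gt_1_nat)

lemma sum_eq_0: "(\<Sum>x\<in>{0..<int q}. f x) = 0"
proof -
  obtain t where t: "\<not> int q dvd t" "f t \<noteq> 1" using nontrivial by blast
  have "(\<Sum>x\<in>{0..<int q}. f x) = (\<Sum>x\<in>{0..<int q}. f (t * x))"
    by (rule sum_mod_periodic_scale[symmetric, OF prime_q periodic t(1)])
  also have "\<dots> = f t * (\<Sum>x\<in>{0..<int q}. f x)" by (simp add: mult sum_distrib_left)
  finally show ?thesis using t by auto
qed

lemma residue_char_cnj: "residue_char q (\<lambda>x. cnj (f x))"
proof
  obtain t where "\<not> int q dvd t" "f t \<noteq> 1" using nontrivial by blast
  then show "\<exists>x. \<not> int q dvd x \<and> cnj (f x) \<noteq> 1"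
    using complex_cnj_cnj complex_cnj_one by metis
qed (use prime_q periodic mult zero unit in \<open>auto simp: mod_periodic_def mult.commute\<close>)

end

definition gauss_sum :: "nat \<Rightarrow> (int \<Rightarrow> complex) \<Rightarrow> complex" where
  "gauss_sum q f = (\<Sum>x\<in>{0..<int q}. f x * root_char q x)"

definition jacobi_sum :: "nat \<Rightarrow> (int \<Rightarrow> complex) \<Rightarrow> (int \<Rightarrow> complex) \<Rightarrow> complex" where
  "jacobi_sum q f h = (\<Sum>x\<in>{0..<int q}. f x * h (1 - x))"

text \<open>Substitute \<open>t * x\<close> for \<open>x\<close>. With \<open>t = p\<close> this
  evaluates the sum that arises when Frobenius turns \<open>root_char q x\<close> into
  \<open>root_char q (p * x)\<close>.\<close>

lemma (in residue_char) gauss_sum_twist: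
  assumes "\<not> int q dvd t"
  shows "(\<Sum>x\<in>{0..<int q}. f x * root_char q (t * x)) = cnj (f t) * gauss_sum q f"
proof -
  have per: "mod_periodic q (\<lambda>x. f x * root_char q x)"
    using periodic mod_periodic_root_char[of q] q_gt_1 by (simp add: mod_periodic_def)
  have "gauss_sum q f = (\<Sum>x\<in>{0..<int q}. f (t * x) * root_char q (t * x))"
    unfolding gauss_sum_def by (rule sum_mod_periodic_scale[symmetric, OF prime_q per assms])
  also have "\<dots> = f t * (\<Sum>x\<in>{0..<int q}. f x * root_char q (t * x))"
    by (simp add: mult sum_distrib_left mult_ac)
  finally have "cnj (f t) * gauss_sum q f =
      (f t * cnj (f t)) * (\<Sum>x\<in>{0..<int q}. f x * root_char q (t * x))"
    by (simp only: mult_ac)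
  then show ?thesis unfolding unit[OF assms] by simp
qed

text \<open>Group the pairs by their sum \<open>s\<close>. The class \<open>s = 0\<close> gives the
  first term; for a unit \<open>s\<close>, scaling \<open>x\<close> by \<open>s\<close> extracts a
  Jacobi sum. A general \<open>g\<close> covers both the additive character and the constant
  1.\<close>

lemma sum_convolution:
  assumes f: "residue_char q f" and h: "residue_char q h" and g: "mod_periodic q g"
    and g_add: "\<And>x y. g (x + y) = g x * g y"
  shows "(\<Sum>x\<in>{0..<int q}. f x * g x) * (\<Sum>x\<in>{0..<int q}. h x * g x) =
    g 0 * h (- 1) * (\<Sum>x\<in>{0..<int q}. f x * h x) +
    jacobi_sum q f h * (\<Sum>x\<in>{0..<int q}. f x * h x * g x)"
proof -
  interpret f: residue_char q f by fact
  interpret h: residue_char q h by fact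
  let ?R = "{0..<int q}"
  have q0: "q > 0" using f.q_gt_1 by simp
  have per: "mod_periodic q (\<lambda>y. f x * h y * g (x + y))" for x
    unfolding mod_periodic_def g_add using h.periodic g by (simp add: mod_periodic_def)
  have "(\<Sum>x\<in>?R. f x * g x) * (\<Sum>x\<in>?R. h x * g x) = (\<Sum>x\<in>?R. \<Sum>y\<in>?R. f x * h y * g (x + y))"
    unfolding sum_product g_add by (simp add: mult_ac)
  also have "\<dots> = (\<Sum>x\<in>?R. \<Sum>s\<in>?R. f x * h (s + (- x)) * g (x + (s + (- x))))"
    by (intro sum.cong refl sum_mod_periodic_shift[OF q0 per, symmetric])
  also have "\<dots> = (\<Sum>s\<in>?R. g s * (\<Sum>x\<in>?R. f x * h (s - x)))"
    by (subst sum.swap) (simp add: sum_distrib_left mult_ac)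
  also have "\<dots> = g 0 * (\<Sum>x\<in>?R. f x * h (- x)) +
      (\<Sum>s\<in>?R - {0}. g s * (\<Sum>x\<in>?R. f x * h (s - x)))"
    using q0 by (subst sum.remove[of _ 0]) auto
  also have "(\<Sum>x\<in>?R. f x * h (- x)) = h (- 1) * (\<Sum>x\<in>?R. f x * h x)"
    unfolding sum_distrib_left
  proof (intro sum.cong refl)
    fix x
    have "h (- x) = h (- 1) * h x" using h.mult[of "- 1" x] by simp
    then show "f x * h (- x) = h (- 1) * (f x * h x)" by (simp only: mult_ac)
  qed
  also have "(\<Sum>s\<in>?R - {0}. g s * (\<Sum>x\<in>?R. f x * h (s - x))) =
      (\<Sum>s\<in>?R - {0}. g s * (f s * h s * jacobi_sum q f h))"
  proof (intro sum.cong refl arg_cong2[where f = "(*)"])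
    fix s assume "s \<in> ?R - {0}"
    then have s: "\<not> int q dvd s" using zdvd_not_zless by auto
    have "mod_periodic q (\<lambda>x. f x * h (s - x))"
      unfolding mod_periodic_def using f.periodic h.periodic
      by (metis mod_diff_right_eq mod_periodic_def)
    from sum_mod_periodic_scale[OF f.prime_q this s]
    have "(\<Sum>x\<in>?R. f x * h (s - x)) = (\<Sum>x\<in>?R. f (s * x) * h (s * (1 - x)))"
      by (simp add: algebra_simps)
    then show "(\<Sum>x\<in>?R. f x * h (s - x)) = f s * h s * jacobi_sum q f h"
      by (simp add: f.mult h.mult jacobi_sum_def sum_distrib_left mult_ac)
  qed
  \<comment> \<open>The index 0 can be restored because \<open>f\<close> vanishes there.\<close>
  also have "\<dots> = (\<Sum>s\<in>?R. g s * (f s * h s * jacobi_sum q f h))"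
    by (rule sum.mono_neutral_left) (auto simp: f.zero)
  also have "\<dots> = jacobi_sum q f h * (\<Sum>x\<in>?R. f x * h x * g x)"
    by (simp add: sum_distrib_left mult_ac)
  finally show ?thesis by (simp only: mult.assoc)
qed

text \<open>The product character is nontrivial, so its values sum to zero and the first term of the
  convolution disappears.\<close>

lemma gauss_sum_mult:
  assumes "residue_char q f" "residue_char q h" "residue_char q (\<lambda>x. f x * h x)"
  shows "gauss_sum q f * gauss_sum q h = jacobi_sum q f h * gauss_sum q (\<lambda>x. f x * h x)"
proof -
  have "q > 0" using residue_char.q_gt_1[OF assms(1)] by simp
  from sum_convolution[OF assms(1,2) mod_periodic_root_char[OF this] root_char_add]
  show ?thesis using residue_char.sum_eq_0[OF assms(3)] by (simp add: gauss_sum_def)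
qed

text \<open>Two uses of the convolution. With \<open>g = 1\<close> both factors on the left vanish,
  which determines the Jacobi sum as \<open>- cnj (f (- 1))\<close>; with the additive character
  this value yields the product.\<close>

lemma (in residue_char) gauss_sum_mult_cnj:
  "gauss_sum q f * gauss_sum q (\<lambda>x. cnj (f x)) = cnj (f (- 1)) * of_nat q"
proof -
  let ?R = "{0..<int q}" and ?h = "\<lambda>x. cnj (f x)"
  have norm: "f x * ?h x = (if x = 0 then 0 else 1)" if "x \<in> ?R" for x
    using that unit[of x] zero[of 0] zdvd_not_zless[of x "int q"] by auto
  have R: "?R = insert 0 (?R - {0})" using q_gt_1 by auto
  have 1: "(\<Sum>x\<in>?R. f x * ?h x) = of_nat q - 1"
  proof -
    have "(\<Sum>x\<in>?R. f x * ?h x) = (\<Sum>x\<in>?R - {0}. 1)"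
      by (subst R, subst sum.insert) (auto simp: zero norm intro!: sum.cong)
    then show ?thesis using q_gt_1 by (simp add: of_nat_diff)
  qed
  have "(\<Sum>x\<in>?R. f x) * (\<Sum>x\<in>?R. ?h x) =
      ?h (- 1) * (of_nat q - 1) + jacobi_sum q f ?h * (of_nat q - 1)"
    using sum_convolution[OF residue_char_axioms residue_char_cnj, of "\<lambda>_. 1"]
    by (simp add: mod_periodic_def 1)
  then have "(?h (- 1) + jacobi_sum q f ?h) * (of_nat q - 1) = 0"
    unfolding sum_eq_0 mult_zero_left distrib_right by (rule sym)
  then have "?h (- 1) + jacobi_sum q f ?h = 0" using q_gt_1 by auto
  then have J: "jacobi_sum q f ?h = - ?h (- 1)" by (simp add: eq_neg_iff_add_eq_0 add.commute)
  have 2: "(\<Sum>x\<in>?R. f x * ?h x * root_char q x) = - 1"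
  proof -
    have "(\<Sum>x\<in>?R. f x * ?h x * root_char q x) = (\<Sum>x\<in>?R - {0}. root_char q x)"
      by (subst R, subst sum.insert) (auto simp: zero norm intro!: sum.cong)
    moreover have "(\<Sum>x\<in>?R. root_char q x) = 1 + (\<Sum>x\<in>?R - {0}. root_char q x)"
      by (subst R, subst sum.insert) auto
    ultimately show ?thesis using sum_root_char[OF q_gt_1] by (simp add: eq_neg_iff_add_eq_0 add.commute)
  qed
  have "q > 0" using q_gt_1 by simp
  from sum_convolution[OF residue_char_axioms residue_char_cnj mod_periodic_root_char[OF this] root_char_add]
  show ?thesis unfolding gauss_sum_def 1 2 J by (simp add: algebra_simps)
qed

section \<open>The quartic character\<close>

lemma prime_generator_exists:
  assumes q: "prime q" "odd q"
  obtains g :: int where "\<not> int q dvd g"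
    "\<forall>j. 0 < j \<and> j < q - 1 \<longrightarrow> \<not> [g ^ j = 1] (mod int q)"
proof -
  obtain g where "\<forall>k>0. residue_primroot (q ^ k) g"
    using residue_primroot_odd_prime_power_exists[OF q] by metis
  then have "0 < (1 :: nat) \<longrightarrow> residue_primroot (q ^ 1) g" by (rule spec)
  then have "residue_primroot q g" by simp
  then have g: "coprime q g" "ord q g = q - 1"
    using q by (auto simp: residue_primroot_def totient_prime)
  show ?thesis
  proof
    show "\<not> int q dvd int g"
      using g q by (metis coprime_absorb_left int_dvd_int_iff not_prime_unit)
    show "\<forall>j. 0 < j \<and> j < q - 1 \<longrightarrow> \<not> [int g ^ j = 1] (mod int q)"
      using ord_minimal g by (metis cong_int_iff of_nat_1 of_nat_power)
  qed
qed

text \<open>Scaling by a primitive root \<open>g\<close> multiplies the sum by \<open>g ^ j\<close>,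
  which is not 1 modulo \<open>q\<close> for \<open>0 < j < q - 1\<close>. For \<open>j = 0\<close>
  the convention \<open>0 ^ 0 = 1\<close> makes the sum equal to \<open>q\<close>.\<close>

lemma sum_powers_cong_0:
  assumes q: "prime q" "odd q" and j: "j < q - 1"
  shows "[(\<Sum>x\<in>{0..<int q}. x ^ j) = 0] (mod int q)"
proof (cases "j = 0")
  case False
  obtain g where g: "\<not> int q dvd g" "\<forall>j. 0 < j \<and> j < q - 1 \<longrightarrow> \<not> [g ^ j = 1] (mod int q)"
    using prime_generator_exists[OF q] .
  let ?S = "\<Sum>x\<in>{0..<int q}. x ^ j"
  have "mod_periodic q (\<lambda>x. (x mod int q) ^ j)" by (simp add: mod_periodic_def)
  from sum_mod_periodic_scale[OF q(1) this g(1)]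
  have "(\<Sum>x\<in>{0..<int q}. (g * x mod int q) ^ j) = ?S" by simp
  moreover have "[(\<Sum>x\<in>{0..<int q}. (g * x mod int q) ^ j) = (\<Sum>x\<in>{0..<int q}. (g * x) ^ j)] (mod int q)"
    by (intro cong_sum cong_pow) simp
  moreover have "(\<Sum>x\<in>{0..<int q}. (g * x) ^ j) = g ^ j * ?S"
    by (simp add: power_mult_distrib sum_distrib_left)
  ultimately have "int q dvd (1 - g ^ j) * ?S"
    by (simp add: cong_iff_dvd_diff algebra_simps)
  moreover have "\<not> int q dvd 1 - g ^ j"
    using g(2) False j by (metis cong_iff_dvd_diff cong_sym gr0I)
  ultimately show ?thesis using q by (simp add: prime_dvd_mult_iff cong_0_iff)
qed (simp add: cong_0_iff)

text \<open>\<open>gauss_red q u z n\<close>: the Gaussian integer \<open>z\<close> maps to \<open>n\<close> under the ring homomorphism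
  from the Gaussian integers to the residues modulo \<open>q\<close> that sends \<open>\<i>\<close> to \<open>u\<close>, where
  \<open>u\<^sup>2 = -1\<close>.\<close>

definition gauss_red :: "nat \<Rightarrow> int \<Rightarrow> complex \<Rightarrow> int \<Rightarrow> bool" where
  "gauss_red q u z n \<longleftrightarrow>
     (\<exists>s t. z = of_int s + of_int t * \<i> \<and> [s + t * u = n] (mod int q))"

text \<open>Fixing \<open>u\<close> fixes a prime of the Gaussian integers above \<open>q\<close>,
  the one modulo which \<open>\<i>\<close> becomes \<open>u\<close>. The theorem takes
  \<open>u\<close> to be the residue \<open>b/a\<close>.\<close>

locale sqrt_minus_1 =
  fixes q :: nat and u :: int
  assumes prime_q: "prime q" and q_mod_4: "q mod 4 = 1" and u2: "[u ^ 2 = - 1] (mod int q)"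
begin

text \<open>The choice of \<open>k\<close> is unique modulo 4, because \<open>u\<close> has order 4.\<close>

definition \<chi> :: "int \<Rightarrow> complex" where
  "\<chi> x = (if int q dvd x then 0
     else \<i> ^ (SOME k. [x ^ ((q - 1) div 4) = u ^ k] (mod int q)))"

lemma q_ge_5: "q \<ge> 5" and odd_q: "odd q"
proof -
  have "q > 1" using prime_q by (rule prime_gt_1_nat)
  with q_mod_4 show "q \<ge> 5" "odd q" by presburger+
qed

lemma q_not_dvd_2: "\<not> int q dvd 2"
  using q_ge_5 by (auto dest: zdvd_imp_le)

lemma prime_dvd_multD: "int q dvd x * y \<Longrightarrow> int q dvd x \<or> int q dvd y"
  using prime_q by (simp add: prime_dvd_mult_iff)

lemma coprime_u: "coprime u (int q)"
proof -
  have "[u * (- u) = 1] (mod int q)"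
    using u2 cong_minus_minus_iff[of "u ^ 2" "- 1" "int q"] by (simp add: power2_eq_square)
  then show ?thesis using coprime_iff_invertible_int by blast
qed

lemma u4: "[u ^ 4 = 1] (mod int q)"
  using cong_pow[OF u2, of 2] by (simp flip: power_mult)

text \<open>Reduce the exponent modulo 4; each of the remainders 1, 2, 3 would force
  \<open>1 = -1\<close> modulo \<open>q\<close>.\<close>

lemma u_power_eq_1:
  assumes "[u ^ d = 1] (mod int q)"
  shows "4 dvd d"
proof -
  have two: "\<not> [1 = - 1] (mod int q)"
    using q_not_dvd_2 by (simp add: cong_iff_dvd_diff)
  have "u ^ d = (u ^ 4) ^ (d div 4) * u ^ (d mod 4)"
    by (simp flip: power_mult power_add)
  moreover have "[(u ^ 4) ^ (d div 4) * u ^ (d mod 4) = 1 ^ (d div 4) * u ^ (d mod 4)] (mod int q)"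
    by (intro cong_mult cong_pow u4 cong_refl)
  ultimately have 1: "[u ^ (d mod 4) = 1] (mod int q)" using assms by (metis cong_sym cong_trans mult_1 power_one)
  have "d mod 4 \<in> {0, 1, 2, 3}" by auto
  moreover have "d mod 4 \<noteq> 1"
  proof
    assume "d mod 4 = 1"
    then have "[u ^ 2 = 1 ^ 2] (mod int q)" using 1 by (intro cong_pow) simp
    with u2 two show False by (metis cong_sym cong_trans power_one)
  qed
  moreover have "d mod 4 \<noteq> 2"
    using 1 u2 two by (metis cong_sym cong_trans)
  moreover have "d mod 4 \<noteq> 3"
  proof
    assume "d mod 4 = 3"
    then have "[u ^ 3 * u = 1 * u] (mod int q)" using 1 by (intro cong_mult) simp_all
    then have "[u ^ 4 = u] (mod int q)" using power_Suc2[of u 3] by simp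
    then have "[u = 1] (mod int q)" using u4 by (metis cong_sym cong_trans)
    then have "[u ^ 2 = 1 ^ 2] (mod int q)" by (intro cong_pow)
    with u2 two show False by (metis cong_sym cong_trans power_one)
  qed
  ultimately show ?thesis by (auto simp: dvd_eq_mod_eq_0)
qed

text \<open>This makes the value of \<open>\<chi>\<close> independent of the chosen exponent: two
  admissible exponents differ by a multiple of 4.\<close>

lemma i_power_eq:
  assumes "[u ^ k = u ^ l] (mod int q)"
  shows "\<i> ^ k = \<i> ^ l"
  using assms
proof (induction k l rule: linorder_wlog)
  case (le k l)
  have "u ^ l = u ^ k * u ^ (l - k)" using le by (simp flip: power_add)
  then have "[u ^ k * u ^ (l - k) = u ^ k * 1] (mod int q)" using le by (simp add: cong_sym)
  then have "[u ^ (l - k) = 1] (mod int q)"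
    using cong_mult_lcancel[of "u ^ k" "int q" "u ^ (l - k)" 1] coprime_u by simp
  then obtain d where "l - k = 4 * d" using u_power_eq_1 by blast
  then have "l = k + 4 * d" using le by simp
  then show ?case by (simp add: power_add power_mult)
qed (simp add: cong_sym)

text \<open>By Fermat the residue \<open>y\<close> satisfies \<open>y ^ 4 = 1\<close>. The
  polynomial splits as \<open>(y - 1) * (y + 1) * (y ^ 2 + 1)\<close>, and its roots modulo
  \<open>q\<close> are the powers of \<open>u\<close>.\<close>

lemma quartic_residue_cases:
  assumes "\<not> int q dvd x"
  shows "\<exists>k. [x ^ ((q - 1) div 4) = u ^ k] (mod int q)"
proof -
  define y where "y = x ^ ((q - 1) div 4)"
  have q4: "q - 1 = (q - 1) div 4 * 4" using q_mod_4 by presburger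
  have "coprime (int q) x" using assms prime_q by (intro prime_imp_coprime) auto
  have "[x * x ^ (q - 1) = x * 1] (mod int q)"
    using fermat_little_int[OF prime_q, of x] q_ge_5 by (simp flip: power_Suc)
  then have "[x ^ (q - 1) = 1] (mod int q)"
    using \<open>coprime (int q) x\<close> cong_mult_lcancel[of x "int q" "x ^ (q - 1)" 1]
    by (simp add: coprime_commute)
  then have "[y ^ 4 = 1] (mod int q)" unfolding y_def power_mult[symmetric] q4[symmetric] .
  then have "int q dvd y ^ 4 - 1" by (simp add: cong_iff_dvd_diff)
  also have "y ^ 4 - 1 = (y - 1) * (y + 1) * (y ^ 2 + 1)" by (simp add: algebra_simps eval_nat_numeral)
  finally consider "int q dvd y - 1" | "int q dvd y + 1" | "int q dvd y ^ 2 + 1"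
    using prime_dvd_multD by blast
  then have "\<exists>k. [y = u ^ k] (mod int q)"
  proof cases
    case 1
    then show ?thesis by (intro exI[of _ 0]) (simp add: cong_iff_dvd_diff)
  next
    case 2
    then have "[y = - 1] (mod int q)" by (simp add: cong_iff_dvd_diff)
    then show ?thesis using u2 by (metis cong_sym cong_trans)
  next
    case 3
    have "int q dvd u ^ 2 + 1" using u2 by (simp add: cong_iff_dvd_diff)
    with 3 have "int q dvd (y ^ 2 + 1) - (u ^ 2 + 1)" by (rule dvd_diff)
    also have "(y ^ 2 + 1) - (u ^ 2 + 1) = (y - u) * (y + u)" by (simp add: power2_eq_square algebra_simps)
    finally consider "int q dvd y - u" | "int q dvd y + u" using prime_dvd_multD by blast
    then show ?thesis
    proof cases
      case 1
      then show ?thesis by (intro exI[of _ 1]) (simp add: cong_iff_dvd_diff)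
    next
      case 2
      then have "[y = (- 1) * u] (mod int q)" by (simp add: cong_iff_dvd_diff)
      moreover have "[u ^ 2 * u = (- 1) * u] (mod int q)" by (intro cong_mult u2 cong_refl)
      ultimately have "[y = u ^ 3] (mod int q)" by (simp add: eval_nat_numeral) (metis cong_sym cong_trans mult.assoc)
      then show ?thesis by blast
    qed
  qed
  then show ?thesis by (simp only: y_def)
qed

lemma \<chi>_eqI:
  assumes "\<not> int q dvd x" "[x ^ ((q - 1) div 4) = u ^ k] (mod int q)"
  shows "\<chi> x = \<i> ^ k"
proof -
  define l where "l = (SOME k. [x ^ ((q - 1) div 4) = u ^ k] (mod int q))"
  have "[x ^ ((q - 1) div 4) = u ^ l] (mod int q)"
    unfolding l_def by (rule someI_ex) (use assms in blast)
  then have "\<i> ^ l = \<i> ^ k" using assms by (intro i_power_eq) (metis cong_sym cong_trans)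
  then show ?thesis using assms by (simp add: \<chi>_def l_def)
qed

lemma \<chi>_E:
  assumes "\<not> int q dvd x"
  obtains k where "\<chi> x = \<i> ^ k" "[x ^ ((q - 1) div 4) = u ^ k] (mod int q)"
  using quartic_residue_cases[OF assms] \<chi>_eqI[OF assms] by blast

lemma \<chi>_0: "int q dvd x \<Longrightarrow> \<chi> x = 0"
  by (simp add: \<chi>_def)

lemma \<chi>_mult: "\<chi> (x * y) = \<chi> x * \<chi> y"
proof (cases "int q dvd x \<or> int q dvd y")
  case False
  obtain k where k: "\<chi> x = \<i> ^ k" "[x ^ ((q - 1) div 4) = u ^ k] (mod int q)" using False \<chi>_E by blast
  obtain l where l: "\<chi> y = \<i> ^ l" "[y ^ ((q - 1) div 4) = u ^ l] (mod int q)" using False \<chi>_E by blast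
  have "\<chi> (x * y) = \<i> ^ (k + l)"
  proof (rule \<chi>_eqI)
    show "\<not> int q dvd x * y" using False prime_dvd_multD by blast
    show "[(x * y) ^ ((q - 1) div 4) = u ^ (k + l)] (mod int q)"
      unfolding power_mult_distrib power_add by (intro cong_mult k l)
  qed
  then show ?thesis by (simp add: k l power_add)
qed (auto simp: \<chi>_0)

lemma \<chi>_periodic: "mod_periodic q \<chi>"
  unfolding mod_periodic_def
proof
  fix x
  show "\<chi> (x mod int q) = \<chi> x"
  proof (cases "int q dvd x")
    case False
    obtain k where k: "\<chi> x = \<i> ^ k" "[x ^ ((q - 1) div 4) = u ^ k] (mod int q)" using False \<chi>_E by blast
    have "[(x mod int q) ^ ((q - 1) div 4) = x ^ ((q - 1) div 4)] (mod int q)"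
      by (intro cong_pow) simp
    then have "\<chi> (x mod int q) = \<i> ^ k"
      using False k by (intro \<chi>_eqI) (auto simp: dvd_mod_iff intro: cong_trans)
    then show ?thesis by (simp add: k)
  qed (auto simp: \<chi>_0 dvd_mod_iff)
qed

lemma \<chi>_power4: "\<not> int q dvd x \<Longrightarrow> \<chi> x ^ 4 = 1"
proof (erule \<chi>_E)
  fix k
  assume "\<chi> x = \<i> ^ k"
  then have "\<chi> x ^ 4 = (\<i> ^ 4) ^ k" by (simp only: power_mult[symmetric] mult.commute)
  then show ?thesis by simp
qed

lemma \<chi>_unit: "\<not> int q dvd x \<Longrightarrow> \<chi> x * cnj (\<chi> x) = 1"
  by (erule \<chi>_E) (simp flip: power_mult_distrib)

lemma \<chi>_cube: "\<chi> x ^ 3 = cnj (\<chi> x)"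
proof (cases "int q dvd x")
  case False
  have "\<chi> x ^ 3 = \<chi> x ^ 3 * (\<chi> x * cnj (\<chi> x))" using \<chi>_unit[OF False] by simp
  also have "\<dots> = \<chi> x ^ 4 * cnj (\<chi> x)" by (simp add: eval_nat_numeral)
  finally show ?thesis using \<chi>_power4[OF False] by simp
qed (simp add: \<chi>_0)

text \<open>At a primitive root \<open>g\<close>, the value 1 would give
  \<open>g ^ ((q - 1) div 2) = 1\<close> modulo \<open>q\<close>.\<close>

lemma \<chi>_sq_nontrivial: "\<exists>x. \<not> int q dvd x \<and> \<chi> x ^ 2 \<noteq> 1"
proof -
  obtain g where g: "\<not> int q dvd g" "\<forall>j. 0 < j \<and> j < q - 1 \<longrightarrow> \<not> [g ^ j = 1] (mod int q)"
    using prime_generator_exists[OF prime_q odd_q] .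
  obtain k where k: "\<chi> g = \<i> ^ k" "[g ^ ((q - 1) div 4) = u ^ k] (mod int q)" using \<chi>_E[OF g(1)] .
  have "\<chi> g ^ 2 \<noteq> 1"
  proof
    assume "\<chi> g ^ 2 = 1"
    then have "(\<i> ^ 2) ^ k = 1" by (simp only: k(1) power_mult[symmetric] mult.commute)
    then have "even k" by (cases "even k") simp_all
    then obtain l where "k = 2 * l" by blast
    then have "[g ^ ((q - 1) div 4 * 2) = (u ^ 4) ^ l] (mod int q)"
      using cong_pow[OF k(2), of 2] by (simp flip: power_mult)
    moreover have "[(u ^ 4) ^ l = 1 ^ l] (mod int q)" by (intro cong_pow u4)
    ultimately have "[g ^ ((q - 1) div 4 * 2) = 1] (mod int q)" by (metis cong_trans power_one)
    moreover have "0 < (q - 1) div 4 * 2" "(q - 1) div 4 * 2 < q - 1" using q_ge_5 by auto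
    ultimately show False using g(2) by blast
  qed
  with g show ?thesis by blast
qed

lemma residue_char_\<chi>: "residue_char q \<chi>"
proof
  show "\<exists>x. \<not> int q dvd x \<and> \<chi> x \<noteq> 1" using \<chi>_sq_nontrivial by force
qed (use prime_q \<chi>_periodic \<chi>_mult \<chi>_0 \<chi>_unit in auto)

lemma residue_char_\<chi>_sq: "residue_char q (\<lambda>x. \<chi> x ^ 2)"
proof
  show "\<chi> x ^ 2 * cnj (\<chi> x ^ 2) = 1" if "\<not> int q dvd x" for x
    using \<chi>_unit[OF that] by (simp flip: power_mult_distrib)
qed (use prime_q \<chi>_periodic \<chi>_sq_nontrivial in
  \<open>auto simp: mod_periodic_def \<chi>_mult \<chi>_0 power_mult_distrib\<close>)

lemma \<chi>_minus_1: "\<chi> (- 1) = (- 1) ^ ((q - 1) div 4)"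
proof -
  have "\<chi> (- 1) = \<i> ^ (2 * ((q - 1) div 4))"
  proof (rule \<chi>_eqI)
    show "\<not> int q dvd - 1" using q_ge_5 by simp
    show "[(- 1) ^ ((q - 1) div 4) = u ^ (2 * ((q - 1) div 4))] (mod int q)"
      unfolding power_mult by (intro cong_pow cong_sym[OF u2])
  qed
  then show ?thesis by (simp add: power_mult)
qed

lemma \<chi>_sq_real: "cnj (\<chi> x ^ 2) = \<chi> x ^ 2"
proof (cases "int q dvd x")
  case False
  obtain k where "\<chi> x = \<i> ^ k" using \<chi>_E[OF False] .
  then have "\<chi> x ^ 2 = (\<i> ^ 2) ^ k" by (simp only: power_mult[symmetric] mult.commute)
  then show ?thesis by simp
qed (simp add: \<chi>_0)

lemma \<chi>_sq: "\<not> int q dvd x \<Longrightarrow> \<chi> x ^ 2 = 1 \<or> \<chi> x ^ 2 = - 1"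
  using \<chi>_power4[of x] by (metis power2_eq_1_iff power_even_eq power_mult numeral_Bit0 mult_2 power_add)

section \<open>Reduction of Gaussian integers modulo the prime above \<open>q\<close>\<close>

lemma gauss_red_add: "gauss_red q u z n \<Longrightarrow> gauss_red q u z' n' \<Longrightarrow> gauss_red q u (z + z') (n + n')"
  unfolding gauss_red_def
proof (elim exE conjE)
  fix s t s' t'
  assume "z = of_int s + of_int t * \<i>" "z' = of_int s' + of_int t' * \<i>"
    and *: "[s + t * u = n] (mod int q)" "[s' + t' * u = n'] (mod int q)"
  then show "\<exists>s t. z + z' = of_int s + of_int t * \<i> \<and> [s + t * u = n + n'] (mod int q)"
    using cong_add[OF *] by (intro exI[of _ "s + s'"] exI[of _ "t + t'"]) (simp add: algebra_simps)
qed

lemma gauss_red_mult: "gauss_red q u z n \<Longrightarrow> gauss_red q u z' n' \<Longrightarrow> gauss_red q u (z * z') (n * n')"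
  unfolding gauss_red_def
proof (elim exE conjE)
  fix s t s' t'
  assume z: "z = of_int s + of_int t * \<i>" "z' = of_int s' + of_int t' * \<i>"
    and *: "[s + t * u = n] (mod int q)" "[s' + t' * u = n'] (mod int q)"
  have "[(s * s' - t * t') + (s * t' + t * s') * u = (s + t * u) * (s' + t' * u)] (mod int q)"
  proof -
    have "(s * s' - t * t') + (s * t' + t * s') * u - (s + t * u) * (s' + t' * u) = - t * t' * (u ^ 2 - - 1)"
      by (simp add: algebra_simps power2_eq_square)
    then show ?thesis using u2 unfolding cong_iff_dvd_diff by simp
  qed
  also have "[(s + t * u) * (s' + t' * u) = n * n'] (mod int q)" by (intro cong_mult *)
  finally show "\<exists>s t. z * z' = of_int s + of_int t * \<i> \<and> [s + t * u = n * n'] (mod int q)"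
    using z by (intro exI[of _ "s * s' - t * t'"] exI[of _ "s * t' + t * s'"]) (simp add: algebra_simps)
qed

lemma gauss_red_of_int: "gauss_red q u (of_int n) n"
  unfolding gauss_red_def by (intro exI[of _ n] exI[of _ 0]) simp

lemma gauss_red_i_power: "gauss_red q u (\<i> ^ k) (u ^ k)"
proof (induction k)
  case 0
  show ?case using gauss_red_of_int[of 1] by simp
next
  case (Suc k)
  have "gauss_red q u \<i> u" unfolding gauss_red_def by (intro exI[of _ 0] exI[of _ 1]) simp
  from gauss_red_mult[OF this Suc] show ?case by simp
qed

lemma gauss_red_cong: "gauss_red q u z n \<Longrightarrow> [n = n'] (mod int q) \<Longrightarrow> gauss_red q u z n'"
  unfolding gauss_red_def by (metis cong_trans)

lemma gauss_red_sum:
  "(\<And>x. x \<in> A \<Longrightarrow> gauss_red q u (f x) (g x)) \<Longrightarrow> gauss_red q u (sum f A) (sum g A)"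
  using gauss_red_of_int[of 0]
  by (induction A rule: infinite_finite_induct) (auto intro: gauss_red_add)

text \<open>This turns character sums into power sums modulo \<open>q\<close>.\<close>

lemma gauss_red_\<chi>: "gauss_red q u (\<chi> x) (x ^ ((q - 1) div 4))"
proof (cases "int q dvd x")
  case True
  then have "int q dvd x ^ ((q - 1) div 4)"
    using q_ge_5 by (intro dvd_trans[OF True dvd_power]) auto
  then have "[0 = x ^ ((q - 1) div 4)] (mod int q)" by (simp add: cong_0_iff cong_sym_eq[of 0])
  with True show ?thesis using gauss_red_of_int[of 0] by (auto simp: \<chi>_0 intro: gauss_red_cong)
next
  case False
  then show ?thesis
    by (elim \<chi>_E) (auto intro: gauss_red_cong[OF gauss_red_i_power] cong_sym)
qed

text \<open>The Jacobi sum reduces to the sum over all residues of a polynomial of degree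
  \<open>2 * m < q - 1\<close>, and every power sum of such a degree vanishes modulo
  \<open>q\<close>.\<close>

lemma jacobi_sum_gauss_red: "gauss_red q u (jacobi_sum q \<chi> \<chi>) 0"
proof -
  define m where "m = (q - 1) div 4"
  have m: "2 * m < q - 1" using q_ge_5 by (simp add: m_def)
  let ?R = "{0..<int q}"
  have "gauss_red q u (jacobi_sum q \<chi> \<chi>) (\<Sum>x\<in>?R. x ^ m * (1 - x) ^ m)"
    unfolding jacobi_sum_def m_def by (intro gauss_red_sum gauss_red_mult gauss_red_\<chi>)
  moreover have "[(\<Sum>x\<in>?R. x ^ m * (1 - x) ^ m) = 0] (mod int q)"
  proof -
    have "(\<Sum>x\<in>?R. x ^ m * (1 - x) ^ m) =
        (\<Sum>x\<in>?R. \<Sum>k\<le>m. (int (m choose k) * (- 1) ^ k) * x ^ (m + k))"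
    proof (intro sum.cong refl)
      fix x :: int
      have "(1 - x) ^ m = (\<Sum>k\<le>m. of_nat (m choose k) * (- x) ^ k)"
        using binomial_ring[of "- x" 1 m] by simp
      then show "x ^ m * (1 - x) ^ m = (\<Sum>k\<le>m. (int (m choose k) * (- 1) ^ k) * x ^ (m + k))"
        by (simp add: sum_distrib_left power_minus[of x] power_add mult_ac)
    qed
    also have "\<dots> = (\<Sum>k\<le>m. (int (m choose k) * (- 1) ^ k) * (\<Sum>x\<in>?R. x ^ (m + k)))"
      by (subst sum.swap) (simp add: sum_distrib_left)
    also have "[\<dots> = (\<Sum>k\<le>m. (int (m choose k) * (- 1) ^ k) * 0)] (mod int q)"
      using m by (intro cong_sum cong_mult cong_refl sum_powers_cong_0 prime_q odd_q) auto
    finally show ?thesis by simp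
  qed
  ultimately show ?thesis by (rule gauss_red_cong)
qed

text \<open>The involution \<open>x \<mapsto> 1 - x\<close> pairs equal terms of the Jacobi sum; its only fixed point
  is \<open>1/2\<close>, that is, \<open>(q + 1) div 2\<close>.\<close>

lemma jacobi_sum_parity:
  "\<exists>s t. jacobi_sum q \<chi> \<chi> = of_int (2 * s + 1) + of_int (2 * t) * \<i>"
proof -
  define F where "F x = \<chi> x * \<chi> (1 - x)" for x
  define h where "h = (int q + 1) div 2"
  have h: "2 * h = int q + 1" "1 \<le> h" "h \<le> int q"
  proof -
    have "odd (int q)" using odd_q by simp
    then show "2 * h = int q + 1" unfolding h_def by presburger
    then show "1 \<le> h" "h \<le> int q" using q_ge_5 by linarith+
  qed
  have \<chi>_per: "\<chi> (x + int q) = \<chi> x" for x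
    by (rule mod_periodicD[OF \<chi>_periodic]) (simp add: cong_def)
  have F_refl: "F (int q + 1 - x) = F x" for x
    using \<chi>_per[of "1 - x"] \<chi>_per[of "x - int q"] by (simp add: F_def algebra_simps)
  have F0: "F 0 = 0" "F (int q) = 0" by (simp_all add: F_def \<chi>_0)
  have "jacobi_sum q \<chi> \<chi> = sum F {0..<int q}" by (simp add: jacobi_sum_def F_def)
  \<comment> \<open>The endpoint 0 is traded for \<open>q\<close>, where \<open>F\<close> vanishes
    too, so that the involution becomes \<open>int q + 1 - x\<close> on the interval from 1 to
    \<open>q\<close>.\<close>
  also have "{0..<int q} = insert 0 {1..<int q}" using q_ge_5 by auto
  also have "sum F \<dots> = sum F (insert (int q) {1..<int q})" by (simp add: F0)
  also have "insert (int q) {1..<int q} = {1..int q}" using q_ge_5 by auto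
  also have "{1..int q} = {1..<h} \<union> ({h} \<union> {h<..int q})" using h by auto
  also have "sum F \<dots> = sum F {1..<h} + (F h + sum F {h<..int q})"
    by (subst sum.union_disjoint; (subst sum.union_disjoint)?) auto
  also have "sum F {h<..int q} = sum F {1..<h}"
    by (rule sum.reindex_bij_witness[of _ "\<lambda>x. int q + 1 - x" "\<lambda>x. int q + 1 - x"])
      (use h F_refl in auto)
  finally have J: "jacobi_sum q \<chi> \<chi> = F h + 2 * sum F {1..<h}" by simp
  have "gauss_red q u (sum F {1..<h}) (\<Sum>x\<in>{1..<h}. x ^ ((q - 1) div 4) * (1 - x) ^ ((q - 1) div 4))"
    unfolding F_def by (intro gauss_red_sum gauss_red_mult gauss_red_\<chi>)
  then obtain s t where st: "sum F {1..<h} = of_int s + of_int t * \<i>"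
    unfolding gauss_red_def by blast
  have "\<not> int q dvd h"
    using h q_ge_5 by (auto dest!: zdvd_imp_le)
  \<comment> \<open>Hence the fixed term is the square of \<open>\<chi> h\<close>, which is 1 or -1
    and makes the real part odd.\<close>
  moreover have "\<chi> (1 - h) = \<chi> h"
  proof -
    have "1 - h + int q = h" using h(1) by simp
    then show ?thesis using \<chi>_per[of "1 - h"] by metis
  qed
  ultimately have "F h = 1 \<or> F h = - 1"
    using \<chi>_sq[of h] by (simp add: F_def power2_eq_square)
  then show ?thesis
  proof
    assume "F h = 1"
    then show ?thesis unfolding J st
      by (intro exI[of _ s] exI[of _ t]) (simp add: algebra_simps)
  next
    assume "F h = - 1"
    then show ?thesis unfolding J st
      by (intro exI[of _ "s - 1"] exI[of _ t]) (simp add: algebra_simps)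
  qed
qed

section \<open>Norm and exact value of the Jacobi sum\<close>

abbreviation "r0 \<equiv> gauss_sum q (\<lambda>x. \<chi> x ^ 2)"

lemma r0_sq: "r0 ^ 2 = of_nat q"
proof -
  have "cnj (\<chi> (- 1) ^ 2) = 1" by (simp add: \<chi>_minus_1 flip: power_mult)
  then show ?thesis
    using residue_char.gauss_sum_mult_cnj[OF residue_char_\<chi>_sq]
    unfolding \<chi>_sq_real by (simp add: power2_eq_square)
qed

lemma gauss_sum_sq: "gauss_sum q \<chi> ^ 2 = jacobi_sum q \<chi> \<chi> * r0"
  using gauss_sum_mult[OF residue_char_\<chi> residue_char_\<chi>] residue_char_\<chi>_sq
  by (simp add: power2_eq_square)

lemma gauss_sum_cnj_sq: "gauss_sum q (\<lambda>x. cnj (\<chi> x)) ^ 2 = cnj (jacobi_sum q \<chi> \<chi>) * r0"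
proof -
  have eq: "(\<lambda>x. cnj (\<chi> x) * cnj (\<chi> x)) = (\<lambda>x. \<chi> x ^ 2)"
    using \<chi>_sq_real by (auto simp: power2_eq_square)
  have "jacobi_sum q (\<lambda>x. cnj (\<chi> x)) (\<lambda>x. cnj (\<chi> x)) = cnj (jacobi_sum q \<chi> \<chi>)"
    by (simp add: jacobi_sum_def)
  then show ?thesis
    using gauss_sum_mult[of q "\<lambda>x. cnj (\<chi> x)" "\<lambda>x. cnj (\<chi> x)"] residue_char.residue_char_cnj[OF residue_char_\<chi>] residue_char_\<chi>_sq
    unfolding eq by (simp add: power2_eq_square)
qed

lemma gauss_sum_mult_cnj:
  "gauss_sum q \<chi> * gauss_sum q (\<lambda>x. cnj (\<chi> x)) = (- 1) ^ ((q - 1) div 4) * of_nat q"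
  using residue_char.gauss_sum_mult_cnj[OF residue_char_\<chi>] by (simp add: \<chi>_minus_1)

text \<open>Multiply the formulas for the squares of the Gauss sums of \<open>\<chi>\<close> and of
  its conjugate; the product of these sums is \<open>q\<close> up to sign.\<close>

lemma jacobi_sum_norm: "jacobi_sum q \<chi> \<chi> * cnj (jacobi_sum q \<chi> \<chi>) = of_nat q"
proof -
  let ?J = "jacobi_sum q \<chi> \<chi>"
  have "?J * cnj ?J * r0 ^ 2 = (gauss_sum q \<chi> * gauss_sum q (\<lambda>x. cnj (\<chi> x))) ^ 2"
    unfolding power_mult_distrib gauss_sum_sq gauss_sum_cnj_sq by (simp add: power2_eq_square)
  also have "\<dots> = of_nat q ^ 2"
    unfolding gauss_sum_mult_cnj by (simp add: power_mult_distrib flip: power_mult)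
  finally show ?thesis using q_ge_5 unfolding r0_sq by (simp add: power2_eq_square)
qed

text \<open>Write the Jacobi sum as \<open>s + t * \<i>\<close>. Its reduction to 0 gives
  \<open>a * s + t * b = int q * e\<close>, and parity gives \<open>e \<noteq> 0\<close>. The
  two-square identity bounds \<open>e ^ 2\<close> by 1, so \<open>e\<close> is a sign and
  \<open>a * t = b * s\<close>.\<close>

lemma jacobi_sum_eq:
  assumes ab: "int q = a ^ 2 + b ^ 2" "odd a" "[a * u = b] (mod int q)"
  obtains \<sigma> :: int where "\<sigma> = 1 \<or> \<sigma> = - 1"
    "jacobi_sum q \<chi> \<chi> = of_int \<sigma> * (of_int a + of_int b * \<i>)"
proof -
  let ?J = "jacobi_sum q \<chi> \<chi>"
  obtain s t where st: "?J = of_int s + of_int t * \<i>" "[s + t * u = 0] (mod int q)"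
    using jacobi_sum_gauss_red unfolding gauss_red_def by blast
  obtain s' t' where "?J = of_int (2 * s' + 1) + of_int (2 * t') * \<i>"
    using jacobi_sum_parity by blast
  with st have "s = 2 * s' + 1" "t = 2 * t'" by (auto simp: complex_eq_iff)
  then have par: "odd s" "even t" by simp_all
  have "of_int (s ^ 2 + t ^ 2) = (of_int (int q) :: complex)"
    using jacobi_sum_norm unfolding st by (simp add: algebra_simps power2_eq_square)
  then have norm: "s ^ 2 + t ^ 2 = int q" by (simp only: of_int_eq_iff)
  have "even b" using ab odd_q by (metis even_add even_of_nat even_power pos2)
  have "[a * s + t * (a * u) = a * 0] (mod int q)"
    using cong_scalar_left[OF st(2), of a] by (simp add: algebra_simps)
  moreover have "[a * s + t * (a * u) = a * s + t * b] (mod int q)"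
    by (intro cong_add cong_mult cong_refl ab)
  ultimately have "[a * s + t * b = 0] (mod int q)" by (metis cong_sym cong_trans mult_zero_right)
  then obtain e where e: "a * s + t * b = int q * e" by (auto simp: cong_0_iff)
  have "odd (a * s + t * b)" using par ab(2) by simp
  then have "e \<noteq> 0" using e by auto
  have q2: "(a * s + t * b) ^ 2 + (a * t - b * s) ^ 2 = int q ^ 2"
  proof -
    have "(a * s + t * b) ^ 2 + (a * t - b * s) ^ 2 = (a ^ 2 + b ^ 2) * (s ^ 2 + t ^ 2)"
      by (simp add: algebra_simps power2_eq_square)
    then show ?thesis unfolding norm ab(1)[symmetric] by (simp add: power2_eq_square)
  qed
  have q0: "int q ^ 2 > 0" using q_ge_5 by simp
  have "int q ^ 2 * e ^ 2 \<le> int q ^ 2 * 1"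
    using q2 unfolding e power_mult_distrib by (smt (verit) zero_le_power2)
  then have "e ^ 2 \<le> 1" using q0 by (simp only: mult_le_cancel_left_pos)
  moreover have "e ^ 2 > 0" using \<open>e \<noteq> 0\<close> by simp
  ultimately have e2: "e ^ 2 = 1" by linarith
  then have e1: "e = 1 \<or> e = - 1" by (simp add: power2_eq_1_iff)
  have "a * t = b * s" using q2 unfolding e power_mult_distrib e2 by simp
  have "int q * s = a * (a * s + t * b)"
    unfolding ab(1) using \<open>a * t = b * s\<close> by (simp add: algebra_simps power2_eq_square)
  then have "s = e * a" using e q_ge_5 by simp
  have "int q * t = b * (a * s + t * b)"
    unfolding ab(1) using \<open>a * t = b * s\<close> by (simp add: algebra_simps power2_eq_square)
  then have "t = e * b" using e q_ge_5 by simp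
  show ?thesis
    using e1 by (rule that) (simp add: st \<open>s = e * a\<close> \<open>t = e * b\<close> algebra_simps)
qed

end

section \<open>The sum of central binomial coefficients\<close>

lemma root_char_power: "root_char q (int k * x) = root_char q x ^ k"
  by (induction k) (simp_all add: root_char_add distrib_right)

context local_ring
begin

lemma gauss_sum_power_eqv:
  assumes "\<And>x. f x \<in> W" "\<And>x. root_char q x \<in> W"
  shows "gauss_sum q f ^ p \<approx> (\<Sum>x\<in>{0..<int q}. f x ^ p * root_char q (int p * x))"
  using eqv_sum_power[of "{0..<int q}" "\<lambda>x. f x * root_char q x"] assms
  by (auto simp: gauss_sum_def root_char_power power_mult_distrib intro: mult)

lemma gauss_sum_mem:
  assumes "\<And>x. f x \<in> W" "\<And>x. root_char q x \<in> W"
  shows "gauss_sum q f \<in> W"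
  unfolding gauss_sum_def using assms by (intro sum mult)

text \<open>This covers all cases of the theorem: for \<open>c\<close> equal to 1, -1,
  \<open>\<i>\<close>, \<open>- \<i>\<close> the right side is 1, -1, \<open>- b/a\<close>,
  \<open>b/a\<close>.\<close>

lemma quartic_sum_eqv:
  fixes a b u :: int and q n :: nat
  defines "c \<equiv> sqrt_minus_1.\<chi> q u (int p)"
  assumes "sqrt_minus_1 q u" and ii: "\<i> \<in> W" and root: "\<And>x. root_char q x \<in> W"
    and ab: "int q = a ^ 2 + b ^ 2" "odd a" "[a * u = b] (mod int q)"
    and p: "p = 2 * n + 1" and pa: "\<not> int p dvd a" and pq: "\<not> int p dvd int q"
  shows "(- 1) ^ (n * ((q - 1) div 4)) *
      (\<Sum>k = 0..p div 4. of_nat ((4 * k) choose (2 * k)) * (of_int (b ^ 2) / (16 * of_nat q)) ^ k) \<approx>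
    c * (if c ^ 2 = 1 then 1 else \<i> * of_int b / of_int a)"
proof -
  interpret sqrt_minus_1 q u by fact
  define m where "m = (q - 1) div 4"
  define s :: complex where "s = (- 1) ^ m"
  define G G' where "G = gauss_sum q \<chi>" and "G' = gauss_sum q (\<lambda>x. cnj (\<chi> x))"
  obtain \<sigma> :: int where \<sigma>: "\<sigma> = 1 \<or> \<sigma> = - 1"
    "jacobi_sum q \<chi> \<chi> = of_int \<sigma> * (of_int a + of_int b * \<i>)"
    using jacobi_sum_eq[OF ab] .
  \<comment> \<open>The sign of the Jacobi sum is absorbed into the square root of \<open>q\<close>,
    so that \<open>\<pi> * r\<close> is exactly the square of \<open>G\<close>.\<close>
  define r where "r = of_int \<sigma> * r0"
  have q0: "(of_nat q :: complex) \<noteq> 0" using q_ge_5 by simp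
  have \<chi>W: "\<chi> x \<in> W" for x
  proof (cases "int q dvd x")
    case False
    obtain k where "\<chi> x = \<i> ^ k" using \<chi>_E[OF False] .
    then show ?thesis using pow[OF ii] by simp
  qed (simp add: \<chi>_0 zero)
  have \<chi>W': "cnj (\<chi> x) \<in> W" "\<chi> x ^ 2 \<in> W" for x
    unfolding \<chi>_cube[symmetric] by (intro pow \<chi>W)+
  have W: "G \<in> W" "G' \<in> W" "r0 \<in> W" "r \<in> W" "s \<in> W"
    unfolding G_def G'_def r_def s_def
    by (intro mult of_int gauss_sum_mem \<chi>W \<chi>W' root pow minus one)+
  have cW: "c \<in> W" unfolding c_def by (rule \<chi>W)
  have r2: "r ^ 2 = of_nat q" using \<sigma>(1) by (auto simp: r_def power_mult_distrib r0_sq)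
  have qp: "\<not> int q dvd int p"
    using pq prime prime_q by (metis int_dvd_int_iff primes_dvd_imp_eq dvd_refl)
  have c1: "c * cnj c = 1" unfolding c_def by (rule \<chi>_unit[OF qp])
  have c2: "c ^ 2 = 1 \<or> c ^ 2 = - 1" unfolding c_def by (rule \<chi>_sq[OF qp])
  \<comment> \<open>The exponent \<open>k\<close> must be positive because \<open>\<chi>\<close>
    vanishes at multiples of \<open>q\<close> while \<open>0 ^ 0 = 1\<close>.\<close>
  have \<chi>_add4: "\<chi> x ^ (k + 4) = \<chi> x ^ k" if "k > 0" for x k
    using that \<chi>_power4[of x] by (cases "int q dvd x") (auto simp: \<chi>_0 power_add)
  have \<chi>_mod4: "\<chi> x ^ (4 * j + k) = \<chi> x ^ k" if "k > 0" for x j k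
  proof (induction j)
    case (Suc j)
    then show ?case using \<chi>_add4[of "4 * j + k" x] that by (simp add: add_ac)
  qed simp
  have GG': "G * G' = s * of_nat q"
    unfolding G_def G'_def s_def m_def by (rule gauss_sum_mult_cnj)
  have G0: "G \<noteq> 0" "G' \<noteq> 0" using GG' q0 by (auto simp: s_def)
  have s2: "s * s = 1" by (simp add: s_def flip: power_mult_distrib)
  \<comment> \<open>\<open>G\<close> is a unit of \<open>W\<close>: its product with
    \<open>G'\<close> is \<open>q\<close> up to sign, and \<open>q\<close> is prime to
    \<open>p\<close>.\<close>
  have invG: "inverse G \<in> W"
  proof -
    have "G * (G' * s * inverse (of_int (int q))) = (s * s) * (of_nat q * inverse (of_nat q))"
      using GG' by (simp add: mult_ac)
    then have "G * (G' * s * inverse (of_int (int q))) = 1"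
      by (simp only: s2 right_inverse[OF q0] mult_1_left)
    then have "inverse G = G' * s * inverse (of_int (int q))" by (rule inverse_unique)
    then show ?thesis using W inverse_int[OF pq] by (simp only: mult)
  qed
  define \<pi> where "\<pi> = of_int a + of_int b * \<i>"
  have \<pi>r: "\<pi> * r = G ^ 2"
    unfolding G_def gauss_sum_sq \<sigma>(2) by (simp add: \<pi>_def r_def)
  \<comment> \<open>Here \<open>p\<close> is 1 modulo 4, so Frobenius fixes the values of
    \<open>\<chi>\<close> and sends \<open>G\<close> to \<open>cnj c * G\<close>.\<close>
  have even: "c * (\<pi> * r) ^ n \<approx> 1" if n: "even n"
  proof (rule eqv_cancel[of G])
    from n obtain j where "n = 2 * j" ..
    then have p4: "p = 4 * j + 1" using p by simp
    have "\<chi> x ^ p = \<chi> x" for x using \<chi>_mod4[of 1 x j] p4 by simp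
    then have "G ^ p \<approx> cnj c * G"
      using gauss_sum_power_eqv[of \<chi>, OF \<chi>W root] residue_char.gauss_sum_twist[OF residue_char_\<chi> qp]
      by (simp add: G_def c_def)
    then have "c * G ^ p \<approx> c * (cnj c * G)" by (intro eqv_mult_left cW)
    moreover have "c * (cnj c * G) = G * 1" using c1 by (simp flip: mult.assoc)
    moreover have "G * (c * (\<pi> * r) ^ n) = c * G ^ p"
      unfolding \<pi>r p by (simp add: power_mult)
    ultimately show "G * (c * (\<pi> * r) ^ n) \<approx> G * 1" by (simp only:)
  qed (use invG G0 in auto)
  \<comment> \<open>Here \<open>p\<close> is 3 modulo 4, so Frobenius conjugates the values of
    \<open>\<chi>\<close> and sends \<open>G\<close> to \<open>c * G'\<close>.\<close>
  have odd: "(\<pi> * r) ^ (n + 1) \<approx> c * s * of_nat q" if n: "odd n"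
  proof -
    from n obtain j where "n = 2 * j + 1" by (elim oddE)
    then have p4: "p = 4 * j + 3" using p by simp
    have "\<chi> x ^ p = cnj (\<chi> x)" for x using \<chi>_mod4[of 3 x j] p4 \<chi>_cube by simp
    then have "G ^ p \<approx> c * G'"
      using gauss_sum_power_eqv[of \<chi>, OF \<chi>W root]
        residue_char.gauss_sum_twist[OF residue_char.residue_char_cnj[OF residue_char_\<chi>] qp]
      by (simp add: G_def G'_def c_def)
    then have "G * G ^ p \<approx> G * (c * G')" by (intro eqv_mult_left W)
    also have "G * (c * G') = c * s * of_nat q" using GG' by (simp add: mult_ac)
    also have "G * G ^ p = (\<pi> * r) ^ (n + 1)" unfolding \<pi>r p power_mult[symmetric] by simp
    finally show ?thesis .
  qed
  have rp: "r ^ p \<approx> c ^ 2 * r"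
  proof -
    have "(\<chi> x ^ 2) ^ p = \<chi> x ^ 2" for x
    proof -
      have "2 * p = 4 * n + 2" using p by simp
      then have "(\<chi> x ^ 2) ^ p = \<chi> x ^ (4 * n + 2)" by (metis power_mult)
      also have "\<dots> = \<chi> x ^ 2" by (rule \<chi>_mod4) simp
      finally show ?thesis .
    qed
    then have "r0 ^ p \<approx> c ^ 2 * r0"
      using gauss_sum_power_eqv[of "\<lambda>x. \<chi> x ^ 2", OF \<chi>W'(2) root]
        residue_char.gauss_sum_twist[OF residue_char_\<chi>_sq qp] \<chi>_sq_real[of "int p"]
      by (simp add: c_def)
    then have "of_int \<sigma> * r0 ^ p \<approx> of_int \<sigma> * (c ^ 2 * r0)" by (intro eqv_mult_left of_int)
    moreover have "of_int \<sigma> ^ p = (of_int \<sigma> :: complex)" using \<sigma>(1) by (auto simp: p)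
    ultimately have "(of_int \<sigma> * r0) ^ p \<approx> of_int \<sigma> * (c ^ 2 * r0)"
      by (simp only: power_mult_distrib)
    then show ?thesis by (simp only: r_def mult_ac)
  qed
  have x2: "(of_int b / r) ^ 2 = of_int (b ^ 2) / of_nat q"
    by (simp add: power_divide r2)
  have "of_int (b ^ 2) * inverse (of_int (int q)) \<in> W" by (intro mult of_int inverse_int pq)
  then have "(of_int b / r) ^ 2 \<in> W" unfolding x2 by (simp add: divide_inverse)
  note sum_central_binomial_eqv[OF p this]
  moreover have "(of_int b / r) ^ 2 / 16 = of_int (b ^ 2) / (16 * of_nat q)"
    unfolding x2 by simp
  ultimately have "(\<Sum>k = 0..p div 4. of_nat ((4 * k) choose (2 * k)) * (of_int (b ^ 2) / (16 * of_nat q)) ^ k) \<approx>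
      ((1 + of_int b / r) ^ n + (1 - of_int b / r) ^ n) / 2"
    by (simp only:)
  also have "\<dots> \<approx> (if even n then 1 else s) * c * (if c ^ 2 = 1 then 1 else \<i> * of_int b / of_int a)"
    using even odd unfolding \<pi>_def
    by (intro half_sum_powers_eqv[OF ii W(4) r2 ab(1) p pa pq cW c2 W(5) rp])
  finally have "s ^ n * (\<Sum>k = 0..p div 4. of_nat ((4 * k) choose (2 * k)) * (of_int (b ^ 2) / (16 * of_nat q)) ^ k) \<approx>
      s ^ n * ((if even n then 1 else s) * c * (if c ^ 2 = 1 then 1 else \<i> * of_int b / of_int a))"
    by (intro eqv_mult_left pow W)
  \<comment> \<open>This is where the sign in front of the sum is used up: the total exponent of
    \<open>s\<close> is even.\<close>
  moreover have "s ^ n * (if even n then 1 else s) = 1"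
    using s2 by (auto elim!: evenE oddE simp: power_mult power2_eq_square)
  ultimately show ?thesis
    by (simp add: s_def m_def mult.commute[of n] flip: power_mult mult.assoc)
qed

end

theorem theorem2p3:
  fixes p q :: nat and a b :: int
  assumes "prime q" and "q mod 4 = 1"
    and "int q = a^2 + b^2" and "odd a"
    and "prime p" and "odd p" and "\<not> int p dvd a * int q"
  defines "S \<equiv> (-1::rat) ^ ((p - 1) div 2 * ((q - 1) div 4)) *
      (\<Sum>k = 0..p div 4. of_nat ((4*k) choose (2*k)) *
         (of_int (b^2) / (16 * of_nat q)) ^ k)"
  shows "([int p ^ ((q - 1) div 4) = 1] (mod int q) \<longrightarrow> rat_cong_mod S 1 p)
       \<and> ([int p ^ ((q - 1) div 4) = -1] (mod int q) \<longrightarrow> rat_cong_mod S (-1) p)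
       \<and> ([a * int p ^ ((q - 1) div 4) = b] (mod int q) \<longrightarrow> rat_cong_mod S (- (of_int b / of_int a)) p)
       \<and> ([a * int p ^ ((q - 1) div 4) = -b] (mod int q) \<longrightarrow> rat_cong_mod S (of_int b / of_int a) p)"
proof -
  define n where "n = (p - 1) div 2"
  have p: "p = 2 * n + 1" using \<open>odd p\<close> unfolding n_def by (auto elim!: oddE)
  have pa: "\<not> int p dvd a" and pq: "\<not> int p dvd int q" using assms(7) by auto
  have q5: "q \<ge> 5" using assms(2) prime_gt_1_nat[OF assms(1)] by presburger
  \<comment> \<open>A common factor \<open>q\<close> of \<open>a\<close> and \<open>b\<close> would
    make the square of \<open>q\<close> divide \<open>q\<close>.\<close>
  have qa: "\<not> int q dvd a"
  proof
    assume "int q dvd a"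
    then have "int q dvd int q - a ^ 2" by (simp add: power2_eq_square)
    then have "int q dvd b ^ 2" using assms(3) by simp
    then have "int q dvd b" using assms(1) prime_dvd_power by (metis prime_nat_int_transfer)
    with \<open>int q dvd a\<close> have "int q ^ 2 dvd a ^ 2 + b ^ 2" by (intro dvd_add) (auto intro: dvd_power_same)
    then show False using assms(3) q5 by (auto simp: power2_eq_square dest: zdvd_imp_le)
  qed
  then have cop: "coprime a (int q)" using assms(1)
    by (metis coprime_commute prime_imp_coprime prime_nat_int_transfer)
  then obtain v where v: "[a * v = 1] (mod int q)" by (auto simp: coprime_iff_invertible_int)
  \<comment> \<open>The residue \<open>b/a\<close>, with \<open>v\<close> the inverse of
    \<open>a\<close>; its square is -1 because \<open>a ^ 2 + b ^ 2\<close> vanishes modulo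
    \<open>q\<close>.\<close>
  define u where "u = b * v"
  have au: "[a * u = b] (mod int q)"
    using cong_scalar_left[OF v, of b] by (simp add: u_def mult_ac)
  have u2: "[u ^ 2 = - 1] (mod int q)"
  proof -
    have "[a ^ 2 * u ^ 2 = b ^ 2] (mod int q)" using cong_pow[OF au, of 2] by (simp add: power_mult_distrib)
    also have "[b ^ 2 = a ^ 2 * - 1] (mod int q)"
      using assms(3) by (simp add: cong_iff_dvd_diff add.commute)
    finally show ?thesis using cop cong_mult_lcancel[of "a ^ 2" "int q" "u ^ 2" "- 1"] by simp
  qed
  interpret sqrt_minus_1 q u using assms(1,2) u2 by unfold_locales
  \<comment> \<open>The order \<open>4 * q\<close> makes both \<open>\<i> = w ^ q\<close> and all
    \<open>q\<close>-th roots of unity powers of \<open>w\<close>.\<close>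
  define w where "w = root_char (4 * q) 1"
  have w: "4 * q > 0" "w ^ (4 * q) = 1"
    using q5 root_char_eq_1[of "4 * q"] by (simp_all add: w_def flip: root_char_nat)
  define W where "W = loc_span p (4 * q) w"
  interpret local_ring W p
    unfolding W_def by (rule local_ring_loc_span[OF \<open>prime p\<close> w])
  have wW: "w ^ k \<in> W" for k
    unfolding W_def using root_span_subset_loc_span[OF \<open>prime p\<close>] root_span_power[OF w] by blast
  have root: "root_char q x \<in> W" for x
  proof -
    have "root_char q (x mod int q) = root_char (4 * q) (int (4 * nat (x mod int q)))"
      using q5 by (simp add: root_char_def mult.assoc)
    also have "\<dots> = w ^ (4 * nat (x mod int q))" by (simp only: root_char_nat w_def)
    finally show ?thesis using wW mod_periodic_root_char[of q] q5 by (simp add: mod_periodic_def)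
  qed
  have ii: "\<i> \<in> W"
  proof -
    have "w ^ q = root_char (4 * q) (int q)" by (simp add: w_def flip: root_char_nat)
    also have "\<dots> = \<i>" using q5 by (simp add: root_char_def cis_pi_half)
    finally show ?thesis using wW[of q] by simp
  qed
  have S: "eqv (of_rat S) (\<chi> (int p) * (if \<chi> (int p) ^ 2 = 1 then 1 else \<i> * of_int b / of_int a))"
    using quartic_sum_eqv[OF sqrt_minus_1_axioms ii root assms(3,4) au p pa pq]
    unfolding S_def n_def
    by (simp add: of_rat_mult of_rat_sum of_rat_power of_rat_divide)
  have qp: "\<not> int q dvd int p"
    using pq assms by (metis int_dvd_int_iff primes_dvd_imp_eq dvd_refl)
  have cancel: "[a * int p ^ ((q - 1) div 4) = a * z] (mod int q) \<Longrightarrow> [int p ^ ((q - 1) div 4) = z] (mod int q)" for z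
    using cop by (simp only: cong_mult_lcancel)
  show ?thesis unfolding rat_cong_mod_def
  proof (intro conjI impI rat_cong_modI)
    assume "[int p ^ ((q - 1) div 4) = 1] (mod int q)"
    then have "\<chi> (int p) = 1" using \<chi>_eqI[OF qp, of 0] by simp
    then show "eqv (of_rat S) (of_rat 1)" using S by simp
  next
    assume "[int p ^ ((q - 1) div 4) = - 1] (mod int q)"
    then have "[int p ^ ((q - 1) div 4) = u ^ 2] (mod int q)" using cong_sym[OF u2] by (rule cong_trans)
    then have "\<chi> (int p) = - 1" using \<chi>_eqI[OF qp, of 2] by simp
    then show "eqv (of_rat S) (of_rat (- 1))" using S by (simp add: of_rat_minus)
  next
    assume "[a * int p ^ ((q - 1) div 4) = b] (mod int q)"
    then have "[a * int p ^ ((q - 1) div 4) = a * u] (mod int q)" using au by (metis cong_sym cong_trans)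
    then have "[int p ^ ((q - 1) div 4) = u ^ 1] (mod int q)" by (intro cancel) simp
    then have "\<chi> (int p) = \<i> ^ 1" by (rule \<chi>_eqI[OF qp])
    then show "eqv (of_rat S) (of_rat (- (of_int b / of_int a)))"
      using S by (simp add: of_rat_minus of_rat_divide)
  next
    assume "[a * int p ^ ((q - 1) div 4) = - b] (mod int q)"
    \<comment> \<open>The residue \<open>- b/a\<close> is \<open>- u\<close>, which is
      \<open>u ^ 3\<close>; so the character takes the value \<open>- \<i>\<close>.\<close>
    also have "[- b = - (a * u)] (mod int q)"
      using cong_sym[OF au] by (simp only: cong_minus_minus_iff)
    also have "- (a * u) = a * (- 1 * u)" by simp
    also have "[a * (- 1 * u) = a * (u ^ 2 * u)] (mod int q)"
      by (intro cong_mult cong_sym[OF u2] cong_refl)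
    also have "a * (u ^ 2 * u) = a * u ^ 3" by (simp add: power3_eq_cube power2_eq_square)
    finally have "[int p ^ ((q - 1) div 4) = u ^ 3] (mod int q)" by (rule cancel)
    then have "\<chi> (int p) = \<i> ^ 3" by (rule \<chi>_eqI[OF qp])
    then have "\<chi> (int p) = - \<i>" by (simp add: power3_eq_cube)
    then show "eqv (of_rat S) (of_rat (of_int b / of_int a))"
      using S by (simp add: of_rat_divide)
  qed
qed

end
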